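(* Let $(y_1,z_1)$ and $(y_2,z_2)$ be distinct elements of $\Theta$. Then the two values $\xi(y_1,z_1;\beta^{-1})$ and $\xi(y_2,z_2;\beta^{-1})$ are algebraically independent for any Pisot or Salem number $\beta$.
   Context: Algebraic independence is over $\mathbb{Q}$. A Pisot number is an algebraic integer greater than $1$ whose conjugates other than itself all have absolute value less than $1$. A Salem number is an algebraic integer greater than $1$ whose conjugates other than itself all have absolute value at most $1$, with at least one conjugate of absolute value exactly $1$. Put $\Theta:=\{(y,z)\in\mathbb{R}^2\mid y>0,\text{ or } y=0\text{ and }z>0\}$. For real $R\geq 3$ and $(y,z)\in\Theta$ put $\varphi(y,z;R):=\exp\left((\log R)^{1+y}(\log\log R)^z\right)=R^{(\log R)^y(\log\log R)^z}$, and set $\xi(y,z;X):=1+\sum_{m=3}^{\infty}X^{\lfloor\varphi(y,z;m)\rfloor}$, where $\lfloor x\rfloor$ is the integral part of $x$. *)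

theory Defs
  imports "HOL-Analysis.Analysis" "HOL-Computational_Algebra.Computational_Algebra"
begin

text \<open>The algebraic conjugates of \<open>x\<close>: all complex roots of its minimal polynomial over the
  rationals (the empty set if \<open>x\<close> is transcendental).\<close>

definition conjugates :: "complex \<Rightarrow> complex set" where
  "conjugates x = {w. \<exists>p :: rat poly. irreducible p \<and> lead_coeff p = 1 \<and>
     poly (map_poly of_rat p) x = 0 \<and> poly (map_poly of_rat p) w = 0}"

definition pisot :: "real \<Rightarrow> bool" where
  "pisot \<beta> \<longleftrightarrow> algebraic_int \<beta> \<and> \<beta> > 1 \<and>
     (\<forall>w \<in> conjugates (of_real \<beta>) - {of_real \<beta>}. norm w < 1)"

definition salem :: "real \<Rightarrow> bool" where
  "salem \<beta> \<longleftrightarrow> algebraic_int \<beta> \<and> \<beta> > 1 \<and>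
     (\<forall>w \<in> conjugates (of_real \<beta>) - {of_real \<beta>}. norm w \<le> 1) \<and>
     (\<exists>w \<in> conjugates (of_real \<beta>). norm w = 1)"

text \<open>A polynomial in two variables \<open>S\<close>, \<open>T\<close> over the rationals is represented as a polynomial in
  \<open>T\<close> whose coefficients are polynomials in \<open>S\<close>.\<close>

definition eval2 :: "rat poly poly \<Rightarrow> 'a :: field_char_0 \<Rightarrow> 'a \<Rightarrow> 'a" where
  "eval2 P s t = poly (map_poly (\<lambda>q. poly (map_poly of_rat q) s) P) t"

lemma eval2_altdef:
  "eval2 P s t = (\<Sum>j\<le>degree P. \<Sum>i\<le>degree (coeff P j). of_rat (coeff (coeff P j) i) * s ^ i * t ^ j)"
proof -
  define f where "f = (\<lambda>q. poly (map_poly of_rat q) s)"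
  have f: "f q = (\<Sum>i\<le>degree q. of_rat (coeff q i) * s ^ i)" for q
    by (simp add: f_def poly_altdef coeff_map_poly degree_map_poly)
  have f0: "f 0 = 0" by (simp add: f)
  have "eval2 P s t = (\<Sum>j\<le>degree (map_poly f P). coeff (map_poly f P) j * t ^ j)"
    unfolding eval2_def f_def by (rule poly_altdef)
  also have "\<dots> = (\<Sum>j\<le>degree P. coeff (map_poly f P) j * t ^ j)"
    using map_poly_degree_leq[of f P] by (intro sum.mono_neutral_left) (auto simp: coeff_eq_0)
  finally show ?thesis by (simp add: coeff_map_poly f0) (simp add: f sum_distrib_right)
qed

definition alg_independent2 :: "'a :: field_char_0 \<Rightarrow> 'a \<Rightarrow> bool" where
  "alg_independent2 s t \<longleftrightarrow> (\<forall>P :: rat poly poly. P \<noteq> 0 \<longrightarrow> eval2 P s t \<noteq> 0)"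

definition Theta :: "(real \<times> real) set" where
  "Theta = {(y, z). y > 0 \<or> y = 0 \<and> z > 0}"

definition phi :: "real \<Rightarrow> real \<Rightarrow> real \<Rightarrow> real" where
  "phi y z R = exp (ln R powr (1 + y) * ln (ln R) powr z)"

lemma phi_altdef:
  assumes "R \<ge> 3"
  shows "phi y z R = R powr (ln R powr y * ln (ln R) powr z)"
proof -
  have "ln R > 0" using assms by simp
  thus ?thesis using assms by (simp add: phi_def powr_add powr_def[of R] mult_ac)
qed

text \<open>The sum starts at \<open>m = 3\<close>, hence the index shift. The exponent \<open>\<lfloor>phi y z m\<rfloor>\<close> is a
  nonnegative integer because \<open>phi\<close> is positive.\<close>

definition xi :: "real \<Rightarrow> real \<Rightarrow> real \<Rightarrow> real" where
  "xi y z X = 1 + (\<Sum>m. X ^ nat \<lfloor>phi y z (real (m + 3))\<rfloor>)"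

end

theory Submission
  imports Defs "HOL-Real_Asymp.Real_Asymp"
begin

text \<open>
  Order the two pairs so that \<open>phi y2 z2\<close> grows faster than every \<open>phi y1 z1 (R ^ K)\<close>, and let
  \<open>F1\<close>, \<open>F2\<close> be the power series with \<open>xi y1 z1 X = F1 X\<close> and \<open>xi y2 z2 X = F2 X\<close>. A polynomial
  relation at \<open>X = 1 / \<beta>\<close>, multiplied by \<open>F2\<close>, gives a power series \<open>c\<close> with integer coefficients
  and \<open>\<Sum>n. c n * X ^ n = 0\<close>.

  Let \<open>W u\<close> be its partial sums. The number \<open>\<beta> ^ u * W u\<close> lies in \<open>\<int>[\<beta>]\<close> and, for \<open>2 * u \<le> N\<close>, it
  and all its conjugates are bounded by about \<open>H = \<Sum>n\<le>N. \<bar>c n\<bar>\<close>, so that it takes at most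
  \<open>O(H ^ d)\<close> values. Hence \<open>W u \<noteq> 0\<close> for at most polynomially (in \<open>H\<close>) many such \<open>u\<close>. For
  \<open>N = \<lfloor>phi y1 z1 M\<rfloor>\<close> the bound \<open>H\<close> is polynomial in \<open>M\<close>, while \<open>N\<close> exceeds every power of \<open>M\<close>.

  Let \<open>F1 ^ g * F2 ^ (h + 1)\<close> be the top monomial of \<open>c\<close>. Up to \<open>N\<close>, the exponents in
  \<open>F1 ^ g * F2 ^ h\<close> leave no gap much longer than \<open>N / M ^ g\<close>, whereas there are only about
  \<open>M ^ (g - 1)\<close> exponents in monomials with a smaller power of \<open>F1\<close>. By counting, some exponent \<open>a\<close> in
  \<open>F1 ^ g * F2 ^ h\<close> is followed by an interval longer than any prescribed power of \<open>M\<close> in which only the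
  top monomial contributes to \<open>c\<close>. It does contribute at \<open>a + s\<close>, for an exponent \<open>s\<close> of \<open>F2\<close> chosen
  near the middle of the interval, and always with the same sign; so \<open>W\<close> cannot vanish both before and
  after \<open>a + s\<close>. But zeros of \<open>W\<close> are so frequent that there are some on both sides.
\<close>

section \<open>Values of integer polynomials at a Pisot or Salem number\<close>

lemma of_int_poly_mult: "map_poly of_int (p * q) = map_poly of_int p * (map_poly of_int q :: 'a :: field_char_0 poly)"
  by (intro poly_eqI) (simp add: coeff_map_poly coeff_mult of_int_sum)

lemma of_int_poly_add: "map_poly of_int (p + q) = map_poly of_int p + (map_poly of_int q :: 'a :: field_char_0 poly)"
  by (intro poly_eqI) (simp add: coeff_map_poly)

lemma of_rat_poly_mult: "map_poly of_rat (p * q) = map_poly of_rat p * (map_poly of_rat q :: 'a :: field_char_0 poly)"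
  by (intro poly_eqI) (simp add: coeff_map_poly coeff_mult of_rat_sum of_rat_mult)

lemma of_rat_poly_add: "map_poly of_rat (p + q) = map_poly of_rat p + (map_poly of_rat q :: 'a :: field_char_0 poly)"
  by (intro poly_eqI) (simp add: coeff_map_poly of_rat_add)

lemma of_rat_poly_of_int_poly: "map_poly of_rat (map_poly of_int p) = (map_poly of_int p :: 'a :: field_char_0 poly)"
  by (intro poly_eqI) (simp add: coeff_map_poly)

lemma poly_of_real_of_int_poly:
  "poly (map_poly of_int q) (of_real x :: complex) = of_real (poly (map_poly of_int q) x)"
  by (induction q) (simp_all add: map_poly_pCons)

lemma common_denominator:
  assumes "finite (S :: rat set)"
  obtains d :: int where "d > 0" "\<And>a. a \<in> S \<Longrightarrow> of_int d * a \<in> \<int>"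
proof -
  have "\<exists>d > 0. \<forall>a\<in>S. of_int d * a \<in> \<int>"
    using assms
  proof (induction S rule: finite_induct)
    case empty
    then show ?case by (intro exI[of _ 1]) auto
  next
    case (insert a S)
    then obtain d :: int where d: "d > 0" "\<forall>a\<in>S. of_int d * a \<in> \<int>" by blast
    obtain u v where uv: "quotient_of a = (u, v)" by fastforce
    have v: "v > 0" using uv by (rule quotient_of_denom_pos)
    then have "of_int v * a = of_int u"
      using quotient_of_div[OF uv] by (simp add: field_simps)
    then have "of_int (d * v) * a = of_int (d * u)" by (simp add: mult.assoc)
    moreover have "of_int (d * v) * b \<in> \<int>" if "b \<in> S" for b
    proof -
      have "of_int (d * v) * b = of_int v * (of_int d * b)" by (simp add: mult_ac)
      moreover have "\<dots> \<in> \<int>" using d that by (simp only: Ints_mult Ints_of_int)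
      ultimately show ?thesis by (simp only:)
    qed
    ultimately have "\<forall>b\<in>insert a S. of_int (d * v) * b \<in> \<int>" by (metis Ints_of_int insertE)
    then show ?case using d v by (intro exI[of _ "d * v"]) auto
  qed
  then show ?thesis using that by blast
qed

lemma clear_denominators:
  fixes P :: "rat poly"
  obtains c :: int and p :: "int poly" where "c > 0" "map_poly of_int p = smult (of_int c) P"
proof -
  obtain c :: int where c: "c > 0" "\<And>a. a \<in> coeff P ` {..degree P} \<Longrightarrow> of_int c * a \<in> \<int>"
    using common_denominator[of "coeff P ` {..degree P}"] by auto
  have int_coeff: "of_int c * coeff P i \<in> \<int>" for i
    using c(2)[of "coeff P i"] by (cases "i \<le> degree P") (auto simp: coeff_eq_0)
  have "map_poly of_int (map_poly (\<lambda>a. \<lfloor>of_int c * a\<rfloor>) P) = smult (of_int c) P"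
    by (intro poly_eqI) (simp add: coeff_map_poly int_coeff)
  with c(1) show ?thesis using that by blast
qed

section \<open>Minimal polynomials and interpolation at the conjugates\<close>

text \<open>A nonzero annihilator of \<open>b\<close> of least degree leaves remainder 0 when
  divided into any other annihilator. Irreducibility follows: in a factorisation one factor
  annihilates \<open>b\<close>, hence is divisible by the whole, and the other factor has degree
  0.\<close>

lemma minimal_polynomial_exists:
  fixes b :: complex and p0 :: "rat poly"
  assumes "poly (map_poly of_rat p0) b = 0" "p0 \<noteq> 0"
  obtains P :: "rat poly" where "irreducible P" "lead_coeff P = 1"
    "\<And>f. poly (map_poly of_rat f) b = 0 \<longleftrightarrow> P dvd f"
proof -
  define Q where "Q f \<longleftrightarrow> f \<noteq> 0 \<and> poly (map_poly of_rat f) b = 0" for f :: "rat poly"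
  have "Q p0" using assms by (simp add: Q_def)
  define P1 where "P1 = arg_min degree Q"
  have P1: "Q P1" and P1_min: "Q f \<Longrightarrow> degree P1 \<le> degree f" for f
    unfolding P1_def using \<open>Q p0\<close> by (auto intro: arg_min_natI arg_min_nat_le)
  define P where "P = smult (inverse (lead_coeff P1)) P1"
  have nz: "P1 \<noteq> 0" using P1 by (simp add: Q_def)
  have deg: "degree P = degree P1" and lead: "lead_coeff P = 1"
    using nz by (simp_all add: P_def)
  have root: "poly (map_poly of_rat P) b = 0"
    using P1 by (simp add: P_def Q_def map_poly_smult of_rat_mult)
  have small: "f = 0" if "poly (map_poly of_rat f) b = 0" "degree f < degree P" for f
    using that P1_min[of f] by (auto simp: Q_def deg)
  have dvd: "poly (map_poly of_rat f) b = 0 \<longleftrightarrow> P dvd f" for f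
  proof
    assume "P dvd f"
    then show "poly (map_poly of_rat f) b = 0" using root by (auto simp: of_rat_poly_mult elim!: dvdE)
  next
    assume f: "poly (map_poly of_rat f) b = 0"
    have "map_poly of_rat f = map_poly of_rat (P * (f div P)) + (map_poly of_rat (f mod P) :: complex poly)"
      by (simp flip: of_rat_poly_add)
    then have "poly (map_poly of_rat (f mod P)) b = 0"
      using f root by (simp add: of_rat_poly_mult)
    moreover have "P \<noteq> 0" using lead by auto
    moreover have "degree P \<noteq> 0"
    proof
      assume "degree P = 0"
      then have "P = 1" using lead by (metis degree_eq_zeroE lead_coeff_pCons(2) one_pCons)
      then show False using root by simp
    qed
    ultimately have "f mod P = 0"
      using small[of "f mod P"] degree_mod_less'[of P f] by auto
    then show "P dvd f" by auto
  qed
  have "irreducible P"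
  proof (rule irreducibleI)
    show "P \<noteq> 0" using lead by auto
    show "\<not> P dvd 1" using dvd[of 1] by auto
    fix A B assume AB: "P = A * B"
    then have nz: "A \<noteq> 0" "B \<noteq> 0" using lead by auto
    then have dg: "degree P = degree A + degree B"
      unfolding AB by (rule degree_mult_eq)
    have "P dvd A \<or> P dvd B"
      using root unfolding AB of_rat_poly_mult poly_mult mult_eq_0_iff by (simp add: dvd flip: AB)
    then have "degree A = 0 \<or> degree B = 0"
      using dvd_imp_degree_le[of P A] dvd_imp_degree_le[of P B] nz dg by auto
    then show "A dvd 1 \<or> B dvd 1" using nz by (auto simp: is_unit_iff_degree)
  qed
  with lead dvd show ?thesis using that by blast
qed

text \<open>Separability in characteristic 0: the minimal polynomial of a common root of
  \<open>P\<close> and \<open>pderiv P\<close> divides both and is associated to \<open>P\<close>,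
  so \<open>P dvd pderiv P\<close>, against the degrees. With this exact count, interpolation at the
  roots determines every polynomial of degree below \<open>degree P\<close>.\<close>

lemma card_roots_irreducible:
  fixes P :: "rat poly"
  assumes "irreducible P"
  shows "card {z :: complex. poly (map_poly of_rat P) z = 0} = degree P"
proof -
  let ?C = "map_poly of_rat :: rat poly \<Rightarrow> complex poly"
  have deg: "degree (?C f) = degree f" for f by (intro degree_map_poly) auto
  have P: "P \<noteq> 0" using assms by auto
  then have P': "degree P \<noteq> 0" using assms irreducible_not_unit[of P] by (simp add: is_unit_iff_degree)
  have "pderiv P \<noteq> 0" using P' by (simp add: pderiv_eq_0_iff)
  then have "\<not> P dvd pderiv P"
    using P' dvd_imp_degree_le[of P "pderiv P"] by (auto simp: degree_pderiv)
  then have not_dvd: "\<not> P dvd pderiv P" .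
  have pd: "?C (pderiv P) = pderiv (?C P)"
    by (intro poly_eqI) (simp add: coeff_map_poly coeff_pderiv of_rat_mult of_rat_add)
  have "rsquarefree (?C P)"
    unfolding rsquarefree_roots
  proof (intro allI notI)
    fix a assume a: "poly (?C P) a = 0 \<and> poly (pderiv (?C P)) a = 0"
    obtain M :: "rat poly" where M: "irreducible M" "\<And>f. poly (?C f) a = 0 \<longleftrightarrow> M dvd f"
      using minimal_polynomial_exists[of P a] a P by metis
    obtain N where N: "P = M * N" using a M(2) by blast
    then have "N dvd 1" using assms M(1) irreducibleD irreducible_not_unit by blast
    moreover have "M dvd pderiv P" using a M(2) pd by metis
    moreover have "P dvd M" using \<open>N dvd 1\<close> N by (simp add: mult_unit_dvd_iff)
    ultimately show False using not_dvd dvd_trans by blast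
  qed
  then have eq: "smult (lead_coeff (?C P)) (\<Prod>z|poly (?C P) z = 0. [:-z, 1:]) = ?C P"
    by (rule complex_poly_decompose_rsquarefree)
  have "?C P \<noteq> 0" using P by (simp add: map_poly_eq_0_iff)
  then have "degree (?C P) = degree (\<Prod>z|poly (?C P) z = 0. [:-z, 1:])"
    by (subst eq [symmetric]) simp
  also have "\<dots> = card {z. poly (?C P) z = 0}"
    by (subst degree_prod_eq_sum_degree) auto
  finally show ?thesis by (simp add: deg)
qed

text \<open>Lagrange interpolation writes \<open>r\<close> in basis polynomials that depend on the
  nodes alone, so one \<open>K\<close> serves all \<open>r\<close>, \<open>B\<close> and
  \<open>i\<close>.\<close>

lemma lagrange_coeff_bound:
  fixes S :: "complex set"
  assumes "finite S"
  obtains K :: real where "K \<ge> 0"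
    "\<And>r B i. degree r < card S \<Longrightarrow> (\<And>w. w \<in> S \<Longrightarrow> norm (poly r w) \<le> B) \<Longrightarrow> norm (coeff r i) \<le> K * B"
proof -
  define L where "L w = (\<Prod>v\<in>S - {w}. [:- v, 1:])" for w
  define K where "K = (\<Sum>w\<in>S. \<Sum>i\<le>card S. norm (coeff (L w) i) / norm (poly (L w) w))"
  have deg: "degree (L w) < card S" if "w \<in> S" for w
  proof -
    have "card S > 0" using that assms by (auto simp: card_gt_0_iff)
    then show ?thesis using that assms unfolding L_def
      by (subst degree_prod_eq_sum_degree) auto
  qed
  have L_other: "poly (L w) v = 0" if "v \<in> S" "v \<noteq> w" for v w
    using that assms by (auto simp: L_def poly_prod)
  have L_same: "poly (L w) w \<noteq> 0" for w
    using assms by (auto simp: L_def poly_prod)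
  have "K \<ge> 0" unfolding K_def by (intro sum_nonneg) auto
  moreover have "norm (coeff r i) \<le> K * B"
    if r: "degree r < card S" "\<And>w. w \<in> S \<Longrightarrow> norm (poly r w) \<le> B" for r B i
  proof -
    have r_eq: "r = (\<Sum>w\<in>S. smult (poly r w / poly (L w) w) (L w))" (is "_ = ?r")
    proof (rule poly_eqI_degree[of S])
      fix v assume v: "v \<in> S"
      have "poly ?r v = (\<Sum>w\<in>S. if w = v then poly r v else 0)"
        unfolding poly_sum using L_other[OF v] L_same by (intro sum.cong) auto
      then show "poly r v = poly ?r v" using v assms by simp
    next
      have "S \<noteq> {}" using r by auto
      then show "degree ?r < card S"
        using assms deg by (intro degree_sum_less) (auto simp: card_gt_0_iff intro: le_less_trans[OF degree_smult_le])
    qed (use r in auto)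
    have "S \<noteq> {}" using r by auto
    then obtain w0 where "w0 \<in> S" by blast
    then have B: "B \<ge> 0" using r(2)[of w0] norm_ge_zero order_trans by blast
    show ?thesis
    proof (cases "i \<le> card S")
      case False
      then have "coeff r i = 0" using r by (intro coeff_eq_0) auto
      then show ?thesis using B \<open>K \<ge> 0\<close> by simp
    next
      case True
      have "norm (coeff r i) = norm (\<Sum>w\<in>S. poly r w / poly (L w) w * coeff (L w) i)"
        by (subst r_eq) (simp add: coeff_sum)
      also have "\<dots> \<le> (\<Sum>w\<in>S. norm (poly r w / poly (L w) w * coeff (L w) i))"
        by (rule norm_sum)
      also have "\<dots> = (\<Sum>w\<in>S. norm (poly r w) * (norm (coeff (L w) i) / norm (poly (L w) w)))"
        by (simp add: norm_mult norm_divide)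
      also have "\<dots> \<le> (\<Sum>w\<in>S. B * (\<Sum>i\<le>card S. norm (coeff (L w) i) / norm (poly (L w) w)))"
        using r True B by (intro sum_mono mult_mono member_le_sum) auto
      also have "\<dots> = K * B" by (simp add: K_def sum_distrib_left mult.commute)
      finally show ?thesis .
    qed
  qed
  ultimately show ?thesis using that by blast
qed

section \<open>Counting elements of \<open>\<int>[\<beta>]\<close> of bounded size\<close>

text \<open>For a Pisot or Salem number, all conjugates other than \<open>\<beta>\<close> lie in the
  closed unit disc. A bound on the whole disc therefore controls the other conjugates of the value
  without naming them, in both cases at once.\<close>

definition bounded_values :: "real \<Rightarrow> nat \<Rightarrow> real set" where
  "bounded_values \<beta> H = {poly (map_poly of_int q) \<beta> | q :: int poly.
     \<bar>poly (map_poly of_int q) \<beta>\<bar> \<le> H \<and>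
     (\<forall>z :: complex. norm z \<le> 1 \<longrightarrow> norm (poly (map_poly of_int q) z) \<le> H)}"

text \<open>A fixed multiple of each value is an integer combination of the powers of
  \<open>\<beta>\<close> below its degree \<open>d\<close>. Its conjugates are O(H), so
  interpolation bounds each of the \<open>d\<close> integer coordinates by O(H).\<close>

lemma card_bounded_values:
  assumes "pisot \<beta> \<or> salem \<beta>"
  obtains C d :: nat where
    "\<And>H. H \<ge> 1 \<Longrightarrow> finite (bounded_values \<beta> H) \<and> card (bounded_values \<beta> H) \<le> C * H ^ d"
proof -
  have "algebraic_int \<beta>" using assms by (auto simp: pisot_def salem_def)
  then obtain p0 :: "int poly" where p0: "poly (map_poly of_int p0) \<beta> = 0" "lead_coeff p0 = 1"
    using algebraic_int_altdef_ipoly by blast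
  define b :: complex where "b = of_real \<beta>"
  have p0b: "poly (map_poly of_int p0) b = 0" by (simp add: b_def poly_of_real_of_int_poly p0)
  have "map_poly of_int p0 \<noteq> (0 :: rat poly)" using p0(2) by (auto simp: map_poly_eq_0_iff)
  then obtain P :: "rat poly" where P: "irreducible P" "lead_coeff P = 1"
    and dvd: "\<And>f. poly (map_poly of_rat f) b = 0 \<longleftrightarrow> P dvd f"
    using minimal_polynomial_exists[of "map_poly of_int p0" b] p0b of_rat_poly_of_int_poly by metis
  define S where "S = {z :: complex. poly (map_poly of_rat P) z = 0}"
  define d where "d = degree P"
  have card_S: "card S = d" unfolding S_def d_def by (rule card_roots_irreducible[OF P(1)])
  have b_in: "b \<in> S" unfolding S_def using dvd by auto
  have P0: "map_poly of_rat P \<noteq> (0 :: complex poly)" using P by (auto simp: map_poly_eq_0_iff)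
  have fin_S: "finite S" unfolding S_def using P0 by (rule poly_roots_finite)
  have d_pos: "d > 0" using b_in fin_S card_S card_gt_0_iff by blast
  have S_conj: "w = b \<or> norm w \<le> 1" if "w \<in> S" for w
  proof -
    have "w \<in> conjugates b" using that b_in P by (auto simp: conjugates_def S_def)
    moreover have "\<forall>w \<in> conjugates (of_real \<beta>) - {of_real \<beta>}. norm w \<le> 1"
      using assms unfolding pisot_def salem_def by (auto intro: less_imp_le)
    ultimately show ?thesis by (auto simp: b_def)
  qed
  \<comment> \<open>An integer multiple of the minimal polynomial; its leading coefficient
    \<open>c\<close> may exceed 1, so dividing by it is a pseudo-division that introduces powers of
    \<open>c\<close>.\<close>
  obtain c p where c: "(c :: int) > 0" and p: "map_poly of_int p = smult (of_int c) P"
    using clear_denominators by blast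
  have deg_p: "degree p = d"
  proof -
    have "degree (map_poly of_int p :: rat poly) = degree p" by (intro degree_map_poly) auto
    then show ?thesis using c p by (simp add: d_def)
  qed
  have lead_p: "coeff p d = c"
  proof -
    have "coeff (map_poly of_int p :: rat poly) d = of_int c" unfolding p using P by (simp add: d_def)
    then show ?thesis by (simp add: coeff_map_poly)
  qed
  have "p \<noteq> 0" using deg_p d_pos by auto
  have pS: "poly (map_poly of_int p) w = 0" if "w \<in> S" for w
  proof -
    have "(map_poly of_int p :: complex poly) = map_poly of_rat (smult (of_int c) P)"
      unfolding p [symmetric] by (simp add: of_rat_poly_of_int_poly)
    then show ?thesis using that by (simp add: map_poly_smult of_rat_mult S_def)
  qed
  have p0S: "poly (map_poly of_int p0) w = 0" if "w \<in> S" for w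
  proof -
    have "P dvd map_poly of_int p0" using p0b by (simp flip: dvd add: of_rat_poly_of_int_poly)
    then obtain Q where "map_poly of_int p0 = P * Q" by blast
    then have "(map_poly of_int p0 :: complex poly) = map_poly of_rat (P * Q)"
      by (metis of_rat_poly_of_int_poly)
    then show ?thesis using that by (simp add: of_rat_poly_mult S_def)
  qed
  \<comment> \<open>Division by the monic \<open>p0\<close> first brings the degree below
    \<open>degree p0\<close> whatever \<open>q\<close> is. The pseudo-division by \<open>p\<close>
    then costs at most the factor \<open>c ^ (degree p0 + 1)\<close>, so a single \<open>a\<close>
    serves every \<open>q\<close>.\<close>
  define a where "a = c ^ (degree p0 + 1)"
  have a: "a > 0" using c by (simp add: a_def)
  have reduce: "\<exists>r :: int poly. degree r < d \<and>
      (\<forall>w\<in>S. of_int a * poly (map_poly of_int q) w = poly (map_poly of_int r) w)" for q :: "int poly"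
  proof -
    obtain s r0 where sr: "pseudo_divmod q p0 = (s, r0)" by fastforce
    have "p0 \<noteq> 0" using p0 by auto
    from pseudo_divmod[OF this sr] p0(2) have q: "q = p0 * s + r0" and r0: "r0 = 0 \<or> degree r0 < degree p0"
      by auto
    obtain t r1 where tr: "pseudo_divmod r0 p = (t, r1)" by fastforce
    define k where "k = Suc (degree r0) - d"
    from pseudo_divmod[OF \<open>p \<noteq> 0\<close> tr] have r0_eq: "smult (c ^ k) r0 = p * t + r1"
      and r1: "r1 = 0 \<or> degree r1 < d"
      by (auto simp: deg_p lead_p k_def)
    have k: "k \<le> degree p0 + 1" using r0 by (auto simp: k_def)
    \<comment> \<open>Pads the multiplier \<open>c ^ k\<close>, which varies with \<open>q\<close>,
      up to the common \<open>a\<close>.\<close>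
    define r where "r = smult (c ^ (degree p0 + 1 - k)) r1"
    have "of_int a * poly (map_poly of_int q) w = poly (map_poly of_int r) w" if w: "w \<in> S" for w
    proof -
      have "poly (map_poly of_int q) w = poly (map_poly of_int r0) w"
        unfolding q using p0S[OF w] by (simp add: of_int_poly_mult of_int_poly_add)
      moreover have "of_int (c ^ k) * poly (map_poly of_int r0) w = poly (map_poly of_int r1) w"
        using arg_cong[OF r0_eq, of "\<lambda>u. poly (map_poly of_int u) w"] pS[OF w]
        by (simp add: of_int_poly_mult of_int_poly_add map_poly_smult)
      moreover have "a = c ^ (degree p0 + 1 - k) * c ^ k"
        unfolding a_def using k by (simp flip: power_add)
      ultimately show ?thesis by (simp add: r_def map_poly_smult mult.assoc)
    qed
    moreover have "degree r < d"
      using r1 d_pos by (auto simp: r_def intro: le_less_trans[OF degree_smult_le])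
    ultimately show ?thesis by blast
  qed
  obtain K0 :: real where K0: "K0 \<ge> 0"
    "\<And>r B i. degree r < card S \<Longrightarrow> (\<And>w. w \<in> S \<Longrightarrow> norm (poly r w) \<le> B) \<Longrightarrow> norm (coeff r i) \<le> K0 * B"
    using lagrange_coeff_bound[OF fin_S] by blast
  define K where "K = nat \<lceil>K0 * of_int a\<rceil>"
  have K: "K0 * of_int a \<le> real K" unfolding K_def by linarith
  define I where "I H = {- int (K * H)..int (K * H)}" for H
  define g where "g f = (\<Sum>i<d. real_of_int (f i) * \<beta> ^ i) / of_int a" for f :: "nat \<Rightarrow> int"
  have sub: "bounded_values \<beta> H \<subseteq> g ` (PiE {..<d} (\<lambda>_. I H))" for H
  proof
    fix y assume "y \<in> bounded_values \<beta> H"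
    then obtain q :: "int poly" where y: "y = poly (map_poly of_int q) \<beta>" "\<bar>poly (map_poly of_int q) \<beta>\<bar> \<le> H"
      and q: "\<And>z :: complex. norm z \<le> 1 \<Longrightarrow> norm (poly (map_poly of_int q) z) \<le> H"
      unfolding bounded_values_def by blast
    obtain r :: "int poly" where r: "degree r < d"
      "\<And>w. w \<in> S \<Longrightarrow> of_int a * poly (map_poly of_int q) w = poly (map_poly of_int r) w"
      using reduce by blast
    have deg_r: "degree (map_poly of_int r :: complex poly) = degree r" by (intro degree_map_poly) auto
    have "norm (poly (map_poly of_int q) w) \<le> H" if "w \<in> S" for w
      using S_conj[OF that] q y(2) by (auto simp: b_def poly_of_real_of_int_poly)
    then have "norm (poly (map_poly of_int r) w) \<le> of_int a * H" if "w \<in> S" for w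
      using that a by (simp flip: r(2) add: norm_mult mult_left_mono)
    then have "norm (coeff (map_poly of_int r :: complex poly) i) \<le> K0 * (of_int a * H)" for i
      using K0(2)[of "map_poly of_int r" "of_int a * H" i] r(1) deg_r card_S by simp
    then have "\<bar>real_of_int (coeff r i)\<bar> \<le> K0 * (of_int a * H)" for i
      by (simp add: coeff_map_poly)
    also have "K0 * (of_int a * H) \<le> real (K * H)"
      using mult_right_mono[OF K, of "real H"] by (simp add: mult.assoc)
    finally have "\<bar>coeff r i\<bar> \<le> int (K * H)" for i
      by (metis of_int_abs of_int_le_iff of_int_of_nat_eq)
    then have "coeff r i \<in> I H" for i unfolding I_def atLeastAtMost_iff by (meson abs_le_D1 abs_le_D2 minus_le_iff)
    then have mem: "restrict (coeff r) {..<d} \<in> PiE {..<d} (\<lambda>_. I H)" by auto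
    have "complex_of_real (of_int a * y) = of_real (poly (map_poly of_int r) \<beta>)"
      using r(2)[OF b_in] by (simp add: b_def poly_of_real_of_int_poly y)
    then have "of_int a * y = poly (map_poly of_int r) \<beta>" by (simp only: of_real_eq_iff)
    also have "\<dots> = (\<Sum>i<d. real_of_int (coeff r i) * \<beta> ^ i)"
      unfolding poly_altdef using r(1)
      by (intro sum.mono_neutral_cong_left) (auto simp: degree_map_poly coeff_map_poly coeff_eq_0)
    finally have "y = g (restrict (coeff r) {..<d})" using a by (simp add: g_def field_simps)
    then show "y \<in> g ` (PiE {..<d} (\<lambda>_. I H))" using mem by blast
  qed
  have fin: "finite (PiE {..<d} (\<lambda>_. I H))" for H
    by (intro finite_PiE) (auto simp: I_def)
  have "finite (bounded_values \<beta> H) \<and> card (bounded_values \<beta> H) \<le> (2 * K + 1) ^ d * H ^ d" if "H \<ge> 1" for H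
  proof
    show "finite (bounded_values \<beta> H)" using sub fin finite_subset by blast
    have "card (bounded_values \<beta> H) \<le> card (PiE {..<d} (\<lambda>_. I H))"
      by (intro surj_card_le[OF fin sub])
    also have "\<dots> = (2 * (K * H) + 1) ^ d"
      by (simp add: card_PiE I_def)  (simp add: nat_add_distrib nat_mult_distrib mult.commute)
    also have "\<dots> \<le> ((2 * K + 1) * H) ^ d" using that by (intro power_mono) (auto simp: algebra_simps)
    also have "\<dots> = (2 * K + 1) ^ d * H ^ d" by (rule power_mult_distrib)
    finally show "card (bounded_values \<beta> H) \<le> (2 * K + 1) ^ d * H ^ d" .
  qed
  then show ?thesis using that by blast
qed

section \<open>Growth of the exponents\<close>

definition log_phi :: "real \<Rightarrow> real \<Rightarrow> real \<Rightarrow> real" where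
  "log_phi y z R = ln R powr (1 + y) * ln (ln R) powr z"

definition log_phi_deriv :: "real \<Rightarrow> real \<Rightarrow> real \<Rightarrow> real" where
  "log_phi_deriv y z R = log_phi y z R * ((1 + y) / (R * ln R) + z / (R * ln R * ln (ln R)))"

lemma phi_eq_exp: "phi y z R = exp (log_phi y z R)"
  by (simp add: phi_def log_phi_def)

lemma phi_pos [simp]: "phi y z R > 0"
  by (simp add: phi_def)

lemma has_real_derivative_log_phi:
  assumes "R \<ge> 3"
  shows "(log_phi y z has_real_derivative log_phi_deriv y z R) (at R)"
proof -
  have "ln 3 \<le> ln R" using assms by simp
  with ln3_gt_1 have 1: "ln R > 1" by linarith
  then have "ln (ln R) > 0" by simp
  with 1 assms show ?thesis
    unfolding log_phi_def[abs_def] log_phi_deriv_def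
    by (auto intro!: derivative_eq_intros simp: field_simps powr_diff)
      (simp add: powr_add)
qed

lemma ThetaE:
  assumes "(y, z) \<in> Theta"
  obtains "y > 0" | "y = 0" "z > 0"
  using assms by (auto simp: Theta_def)

text \<open>\<open>R\<close> times the derivative behaves like
  \<open>(1 + y) * ln R powr y * ln (ln R) powr z\<close>, which tends to infinity exactly because
  of the conditions in \<open>Theta\<close>.\<close>

lemma eventually_log_phi_deriv_ge:
  assumes "(y, z) \<in> Theta"
  shows "eventually (\<lambda>R. log_phi_deriv y z R \<ge> 1 / R) at_top"
proof (rule ThetaE[OF assms])
  assume "y > 0"
  then show ?thesis unfolding log_phi_deriv_def log_phi_def by real_asymp
next
  assume "y = 0" "z > 0"
  then show ?thesis unfolding log_phi_deriv_def log_phi_def by simp real_asymp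
qed

text \<open>\<open>R\<close> times the derivative is polylogarithmic in \<open>R\<close>, hence
  below every positive power.\<close>

lemma eventually_log_phi_deriv_le:
  assumes "\<epsilon> > 0"
  shows "eventually (\<lambda>R. log_phi_deriv y z R \<le> R powr (- 1 + \<epsilon>)) at_top"
proof -
  have "((\<lambda>R. log_phi_deriv y z R / R powr (- 1 + \<epsilon>)) \<longlongrightarrow> 0) at_top"
    using assms unfolding log_phi_deriv_def log_phi_def by real_asymp
  then have "eventually (\<lambda>R. log_phi_deriv y z R / R powr (- 1 + \<epsilon>) < 1) at_top"
    by (rule order_tendstoD) simp
  then show ?thesis
    using eventually_gt_at_top[of 0] by eventually_elim (simp add: divide_simps)
qed

lemma eventually_phi_mono:
  assumes "(y, z) \<in> Theta"
  shows "eventually (\<lambda>R. \<forall>R'\<ge>R. phi y z R \<le> phi y z R') at_top"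
proof -
  obtain R0 where R0: "R0 \<ge> 3" "\<And>R. R \<ge> R0 \<Longrightarrow> log_phi_deriv y z R \<ge> 1 / R"
    using eventually_log_phi_deriv_ge[OF assms] unfolding eventually_at_top_linorder
    by (metis max.cobounded1 max.cobounded2 order_trans)
  have "log_phi y z R \<le> log_phi y z R'" if "R \<ge> R0" "R' \<ge> R" for R R'
  proof (rule DERIV_nonneg_imp_nondecreasing[OF that(2)])
    fix x assume "R \<le> x" "x \<le> R'"
    then have "x \<ge> 3" "log_phi_deriv y z x \<ge> 1 / x" using that R0 by auto
    moreover have "1 / x \<ge> 0" using \<open>x \<ge> 3\<close> by simp
    ultimately show "\<exists>D. (log_phi y z has_real_derivative D) (at x) \<and> 0 \<le> D"
      using has_real_derivative_log_phi[of x y z] order_trans by blast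
  qed
  then show ?thesis
    unfolding eventually_at_top_linorder phi_eq_exp by auto
qed

lemma log_phi_increment:
  assumes "R \<ge> 3"
  obtains x where "R < x" "x < R + 1" "log_phi y z (R + 1) = log_phi y z R + log_phi_deriv y z x"
proof -
  obtain x where "R < x" "x < R + 1"
    "log_phi y z (R + 1) - log_phi y z R = (R + 1 - R) * log_phi_deriv y z x"
    using MVT2[of R "R + 1" "log_phi y z" "log_phi_deriv y z"] has_real_derivative_log_phi assms
    by force
  then show ?thesis using that by (simp add: algebra_simps)
qed

lemma eventually_phi_ge_powr:
  assumes "(y, z) \<in> Theta"
  shows "eventually (\<lambda>R. phi y z R \<ge> R powr K) at_top"
proof (rule ThetaE[OF assms])
  assume "y > 0"
  then have "eventually (\<lambda>R. log_phi y z R \<ge> K * ln R) at_top"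
    unfolding log_phi_def by real_asymp
  then show ?thesis
    using eventually_gt_at_top[of 0] by eventually_elim (simp add: phi_eq_exp powr_def)
next
  assume "y = 0" "z > 0"
  then have "eventually (\<lambda>R. log_phi y z R \<ge> K * ln R) at_top"
    unfolding log_phi_def by simp real_asymp
  then show ?thesis
    using eventually_gt_at_top[of 0] by eventually_elim (simp add: phi_eq_exp powr_def)
qed

text \<open>The relative increment is at least \<open>1 / (R + 1)\<close>, while
  \<open>phi y z R\<close> exceeds \<open>R + 1\<close>. A jump of 1 survives rounding down, so
  integer parts can be compared later on.\<close>

lemma eventually_phi_Suc_ge:
  assumes "(y, z) \<in> Theta"
  shows "eventually (\<lambda>R. phi y z (R + 1) \<ge> phi y z R + 1) at_top"
proof -
  obtain R0 where R0: "\<And>R. R \<ge> R0 \<Longrightarrow> log_phi_deriv y z R \<ge> 1 / R"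
    using eventually_log_phi_deriv_ge[OF assms] unfolding eventually_at_top_linorder by blast
  show ?thesis
    using eventually_ge_at_top[of R0] eventually_ge_at_top[of 3] eventually_phi_ge_powr[OF assms, of 2]
  proof eventually_elim
    case (elim R)
    obtain x where x: "R < x" "x < R + 1" "log_phi y z (R + 1) = log_phi y z R + log_phi_deriv y z x"
      using log_phi_increment elim by blast
    have "1 / (R + 1) \<le> 1 / x" using x elim by (intro divide_left_mono) auto
    then have "1 / (R + 1) \<le> log_phi_deriv y z x" using R0[of x] x elim by auto
    then have "1 + 1 / (R + 1) \<le> exp (log_phi_deriv y z x)"
      using exp_ge_add_one_self[of "log_phi_deriv y z x"] by linarith
    then have 1: "phi y z R * (1 + 1 / (R + 1)) \<le> phi y z (R + 1)"
      unfolding phi_eq_exp x(3) exp_add by (intro mult_left_mono) auto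
    have "3 * R \<le> R * R" using elim by (intro mult_right_mono) auto
    then have "R + 1 \<le> R * R" using elim by linarith
    then have "phi y z R \<ge> R + 1" using elim by (simp add: power2_eq_square)
    then have "phi y z R * (1 / (R + 1)) \<ge> 1" using elim by (simp add: field_simps)
    with 1 show ?case by (simp add: algebra_simps)
  qed
qed

text \<open>Source of the density of the exponents: the relative distance between neighbours is
  almost as small as \<open>1 / R\<close>.\<close>

lemma eventually_phi_Suc_le:
  assumes "0 < \<epsilon>" "\<epsilon> < 1"
  shows "eventually (\<lambda>R. phi y z (R + 1) \<le> phi y z R * (1 + R powr (- 1 + \<epsilon>))) at_top"
proof -
  \<comment> \<open>The exponent is halved to leave room for replacing \<open>exp t\<close> by
    \<open>1 + t\<close>.\<close>
  have "eventually (\<lambda>R. log_phi_deriv y z R \<le> R powr (- 1 + \<epsilon> / 2)) at_top"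
    using assms by (intro eventually_log_phi_deriv_le) auto
  then obtain R0 where R0: "\<And>R. R \<ge> R0 \<Longrightarrow> log_phi_deriv y z R \<le> R powr (- 1 + \<epsilon> / 2)"
    unfolding eventually_at_top_linorder by blast
  have "eventually (\<lambda>R. exp (R powr (- 1 + \<epsilon> / 2)) \<le> 1 + R powr (- 1 + \<epsilon>)) at_top"
    using assms by real_asymp
  then show ?thesis
    using eventually_ge_at_top[of R0] eventually_ge_at_top[of 3]
  proof eventually_elim
    case (elim R)
    obtain x where x: "R < x" "x < R + 1" "log_phi y z (R + 1) = log_phi y z R + log_phi_deriv y z x"
      using log_phi_increment elim by blast
    have "log_phi_deriv y z x \<le> x powr (- 1 + \<epsilon> / 2)" using R0 x elim by auto
    also have "\<dots> \<le> R powr (- 1 + \<epsilon> / 2)" using x elim assms by (intro powr_mono2') auto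
    finally have "exp (log_phi_deriv y z x) \<le> exp (R powr (- 1 + \<epsilon> / 2))" by simp
    also have "\<dots> \<le> 1 + R powr (- 1 + \<epsilon>)" by (rule elim)
    finally show ?case unfolding phi_eq_exp x(3) exp_add by (intro mult_left_mono) auto
  qed
qed

text \<open>Values at indices below \<open>R powr (1 - \<delta>)\<close> are negligible even after
  multiplication by any power of \<open>R\<close>. In logarithms the smaller argument saves at least
  \<open>\<delta> * t * h t\<close> with \<open>t = ln R\<close>, and \<open>h\<close> tends to
  infinity.\<close>

lemma eventually_phi_powr_le:
  assumes "(y, z) \<in> Theta" "0 < \<delta>" "\<delta> < 1"
  shows "eventually (\<lambda>R. phi y z (R powr (1 - \<delta>)) * R powr K \<le> phi y z R) at_top"
proof -
  \<comment> \<open>Chosen so that \<open>phi y z R = R powr h (ln R)\<close>.\<close>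
  define h where "h t = t powr y * ln t powr z" for t :: real
  define h' where "h' t = h t * (y / t + z / (t * ln t))" for t :: real
  have deriv: "(h has_real_derivative h' t) (at t)" if "t > 1" for t
    using that unfolding h_def[abs_def] h'_def
    by (auto intro!: derivative_eq_intros simp: field_simps powr_diff)
  have "eventually (\<lambda>t. h' t \<ge> 0) at_top"
  proof (rule ThetaE[OF assms(1)])
    assume "y > 0"
    then show ?thesis unfolding h'_def h_def by real_asymp
  next
    assume "y = 0" "z > 0"
    show ?thesis using eventually_gt_at_top[of 1]
      by eventually_elim (use \<open>y = 0\<close> \<open>z > 0\<close> in \<open>simp add: h'_def h_def\<close>)
  qed
  then obtain T where T: "T > 1" "\<And>t. t \<ge> T \<Longrightarrow> h' t \<ge> 0"
    unfolding eventually_at_top_linorder by (metis gt_ex max.strict_coboundedI1 max.cobounded1 max.cobounded2 order_trans max.strict_coboundedI2)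
  have mono: "h s \<le> h t" if "s \<ge> T" "t \<ge> s" for s t
  proof (rule DERIV_nonneg_imp_nondecreasing[OF that(2)])
    fix x assume "s \<le> x" "x \<le> t"
    then show "\<exists>D. (h has_real_derivative D) (at x) \<and> 0 \<le> D"
      using that T deriv[of x] by auto
  qed
  have "eventually (\<lambda>t. h t \<ge> K / \<delta>) at_top"
  proof (rule ThetaE[OF assms(1)])
    assume "y > 0"
    then show ?thesis unfolding h_def by real_asymp
  next
    assume "y = 0" "z > 0"
    then have "eventually (\<lambda>t. ln t powr z \<ge> K / \<delta>) at_top" by real_asymp
    then show ?thesis using eventually_gt_at_top[of 1]
      by eventually_elim (use \<open>y = 0\<close> in \<open>simp add: h_def\<close>)
  qed
  then have "eventually (\<lambda>R. h (ln R) \<ge> K / \<delta>) at_top"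
    by (rule eventually_compose_filterlim[OF _ ln_at_top])
  moreover have "eventually (\<lambda>R. (1 - \<delta>) * ln R \<ge> T) at_top"
    using assms by real_asymp
  ultimately show ?thesis using eventually_gt_at_top[of 1]
  proof eventually_elim
    case (elim R)
    define t where "t = ln R"
    have t: "t > 0" using elim by (simp add: t_def)
    have lp: "log_phi y z r = ln r * h (ln r)" if "r > 1" for r
      using that by (simp add: log_phi_def h_def powr_add)
    have "(1 - \<delta>) * t * h ((1 - \<delta>) * t) \<le> (1 - \<delta>) * t * h t"
      using elim assms t by (intro mult_left_mono mono) (auto simp: t_def mult_le_cancel_right1)
    moreover have "K * t \<le> \<delta> * h t * t"
      using elim assms t by (intro mult_right_mono) (auto simp: t_def field_simps)
    ultimately have "(1 - \<delta>) * t * h ((1 - \<delta>) * t) + K * t \<le> t * h t"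
      by (simp add: algebra_simps)
    moreover have "R powr (1 - \<delta>) > 1" using elim assms by (intro gr_one_powr) auto
    ultimately have "log_phi y z (R powr (1 - \<delta>)) + K * t \<le> log_phi y z R"
      using elim by (simp add: lp t_def ln_powr)
    then show ?case using elim
      by (simp add: phi_eq_exp powr_def t_def flip: exp_add)
  qed
qed

text \<open>Replacing \<open>R\<close> by \<open>R ^ K\<close> only multiplies \<open>ln R\<close>
  by \<open>K\<close>. This changes the logarithm of \<open>phi\<close> by a bounded factor, which
  any strict lexicographic increase of the parameters outweighs.\<close>

lemma eventually_phi_power_le:
  assumes "y1 < y2 \<or> y1 = y2 \<and> z1 < z2" "K > 0"
  shows "eventually (\<lambda>R. phi y1 z1 (R ^ K) \<le> phi y2 z2 R) at_top"
proof -
  have K: "real K > 0" using assms by simp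
  have "eventually (\<lambda>t. (real K * t) powr (1 + y1) * ln (real K * t) powr z1 \<le> (t :: real) powr (1 + y2) * ln t powr z2) at_top"
    using assms(1)
  proof
    assume "y1 < y2"
    with K show ?thesis by real_asymp
  next
    assume "y1 = y2 \<and> z1 < z2"
    with K show ?thesis by simp real_asymp
  qed
  then have "eventually (\<lambda>R. (real K * ln R) powr (1 + y1) * ln (real K * ln R) powr z1 \<le> ln R powr (1 + y2) * ln (ln R) powr z2) at_top"
    by (rule eventually_compose_filterlim[OF _ ln_at_top])
  then show ?thesis using eventually_gt_at_top[of 0]
    by eventually_elim (simp add: phi_def ln_realpow)
qed

section \<open>The integer exponents: their number and spacing\<close>

definition expo :: "real \<Rightarrow> real \<Rightarrow> nat \<Rightarrow> nat" where
  "expo y z m = nat \<lfloor>phi y z (real (m + 3))\<rfloor>"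

lemma expo_le: "real (expo y z m) \<le> phi y z (real (m + 3))"
  unfolding expo_def using phi_pos[of y z "real (m + 3)"] by (simp add: less_imp_le)

lemma expo_gt: "phi y z (real (m + 3)) < real (expo y z m) + 1"
  unfolding expo_def using phi_pos[of y z "real (m + 3)"] by linarith

lemma eventually_expo_ge:
  assumes "(y, z) \<in> Theta"
  shows "eventually (\<lambda>m. expo y z m \<ge> m) sequentially"
proof -
  have "filterlim (\<lambda>m. real (m + 3)) at_top sequentially" by real_asymp
  from eventually_compose_filterlim[OF eventually_phi_ge_powr[OF assms, of 1] this]
  show ?thesis
  proof eventually_elim
    case (elim m)
    then show ?case using expo_gt[of y z m] by simp
  qed
qed

lemma finite_expo_le:
  assumes "(y, z) \<in> Theta"
  shows "finite {m. expo y z m \<le> n}"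
proof -
  obtain m0 where "\<And>m. m \<ge> m0 \<Longrightarrow> expo y z m \<ge> m"
    using eventually_expo_ge[OF assms] unfolding eventually_sequentially by blast
  then have "{m. expo y z m \<le> n} \<subseteq> {..max m0 n}"
    by (auto simp: le_max_iff_disj) (meson le_trans nat_le_linear)
  then show ?thesis using finite_subset by blast
qed

text \<open>For negative \<open>z\<close> the exponents may decrease at first, so the last index
  whose exponent is at most \<open>x\<close> is taken; finiteness provides it.\<close>

lemma expo_bracket:
  assumes "(y, z) \<in> Theta" "expo y z m0 \<le> x"
  obtains m where "m \<ge> m0" "expo y z m \<le> x" "x < expo y z (Suc m)"
proof -
  let ?A = "{m. expo y z m \<le> x}"
  have fin: "finite ?A" by (rule finite_expo_le[OF assms(1)])
  have in_A: "m0 \<in> ?A" using assms by simp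
  have "Max ?A \<in> ?A" using fin in_A by (intro Max_in) auto
  moreover have "Max ?A \<ge> m0" using fin in_A by (rule Max_ge)
  moreover have "Suc (Max ?A) \<notin> ?A" using Max_ge[OF fin, of "Suc (Max ?A)"] by auto
  ultimately show ?thesis using that[of "Max ?A"] by auto
qed

lemma phi_jump:
  assumes "(y, z) \<in> Theta"
  obtains R0 where "\<And>R R'. R \<ge> R0 \<Longrightarrow> R' \<ge> R \<Longrightarrow> phi y z R \<le> phi y z R'"
    "\<And>R. R \<ge> R0 \<Longrightarrow> phi y z (R + 1) \<ge> phi y z R + 1"
proof -
  have "eventually (\<lambda>R. (\<forall>R'\<ge>R. phi y z R \<le> phi y z R') \<and> phi y z (R + 1) \<ge> phi y z R + 1) at_top"
    using eventually_phi_mono[OF assms] eventually_phi_Suc_ge[OF assms] by eventually_elim auto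
  then show ?thesis using that unfolding eventually_at_top_linorder by blast
qed

text \<open>An index \<open>m \<ge> M\<close> has argument \<open>m + 3 \<ge> M + 1\<close>, and the
  jump of \<open>phi\<close> by 1 keeps its integer part above that of \<open>phi y z M\<close>. So
  at most \<open>M\<close> exponents lie up to the truncation point.\<close>

lemma eventually_expo_le_imp:
  assumes "(y, z) \<in> Theta"
  shows "eventually (\<lambda>M. \<forall>m. expo y z m \<le> nat \<lfloor>phi y z (real M)\<rfloor> \<longrightarrow> m < M) sequentially"
proof -
  obtain R0 where R0: "\<And>R R'. R \<ge> R0 \<Longrightarrow> R' \<ge> R \<Longrightarrow> phi y z R \<le> phi y z R'"
    "\<And>R. R \<ge> R0 \<Longrightarrow> phi y z (R + 1) \<ge> phi y z R + 1"
    using phi_jump[OF assms] by metis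
  have "eventually (\<lambda>M. real M \<ge> R0) sequentially" by real_asymp
  then show ?thesis
  proof eventually_elim
    case (elim M)
    show ?case
    proof (intro allI impI, rule ccontr)
      fix m assume m: "expo y z m \<le> nat \<lfloor>phi y z (real M)\<rfloor>" "\<not> m < M"
      have "phi y z (real M) + 1 \<le> phi y z (real M + 1)" using R0 elim by auto
      also have "\<dots> \<le> phi y z (real (m + 3))" using m elim by (intro R0) auto
      also have "\<dots> < real (expo y z m) + 1" by (rule expo_gt)
      finally show False using m(1) phi_pos[of y z "real M"] by linarith
    qed
  qed
qed

text \<open>Up to the \<open>M\<close>-th value of the slower function, the faster one has only
  about \<open>M powr (1 / K)\<close> exponents: at an index with \<open>m ^ K > M\<close> it
  already dominates the slower function at \<open>M + 1\<close>. \<open>C\<close> sets aside the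
  indices before this domination begins.\<close>

lemma eventually_expo_le_imp_sparse:
  assumes "(y1, z1) \<in> Theta" "y1 < y2 \<or> y1 = y2 \<and> z1 < z2" "K > 0"
  obtains C where
    "eventually (\<lambda>M. \<forall>m. expo y2 z2 m \<le> nat \<lfloor>phi y1 z1 (real M)\<rfloor> \<longrightarrow> m < C \<or> m ^ K \<le> M) sequentially"
proof -
  obtain R0 where R0: "\<And>R R'. R \<ge> R0 \<Longrightarrow> R' \<ge> R \<Longrightarrow> phi y1 z1 R \<le> phi y1 z1 R'"
    "\<And>R. R \<ge> R0 \<Longrightarrow> phi y1 z1 (R + 1) \<ge> phi y1 z1 R + 1"
    using phi_jump[OF assms(1)] by metis
  obtain R2 where R2: "\<And>R. R \<ge> R2 \<Longrightarrow> phi y1 z1 (R ^ K) \<le> phi y2 z2 R"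
    using eventually_phi_power_le[OF assms(2,3)] unfolding eventually_at_top_linorder by blast
  define C where "C = nat \<lceil>R2\<rceil>"
  have "eventually (\<lambda>M. real M \<ge> R0) sequentially" by real_asymp
  then have "eventually (\<lambda>M. \<forall>m. expo y2 z2 m \<le> nat \<lfloor>phi y1 z1 (real M)\<rfloor> \<longrightarrow> m < C \<or> m ^ K \<le> M) sequentially"
  proof eventually_elim
    case (elim M)
    show ?case
    proof (intro allI impI, rule ccontr)
      fix m assume m: "expo y2 z2 m \<le> nat \<lfloor>phi y1 z1 (real M)\<rfloor>" "\<not> (m < C \<or> m ^ K \<le> M)"
      have "phi y1 z1 (real M) + 1 \<le> phi y1 z1 (real M + 1)" using R0 elim by auto
      also have "\<dots> \<le> phi y1 z1 (real (m + 3) ^ K)"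
      proof (rule R0)
        have "M + 1 \<le> m ^ K" using m by simp
        also have "\<dots> \<le> (m + 3) ^ K" by (intro power_mono) auto
        finally have "real (M + 1) \<le> real ((m + 3) ^ K)" by (simp only: of_nat_le_iff)
        then show "real M + 1 \<le> real (m + 3) ^ K" by simp
      qed (use elim in auto)
      also have "\<dots> \<le> phi y2 z2 (real (m + 3))"
        using m(2) by (intro R2) (auto simp: C_def not_less)
      also have "\<dots> < real (expo y2 z2 m) + 1" by (rule expo_gt)
      finally show False using m(1) phi_pos[of y1 z1 "real M"] by linarith
    qed
  qed
  then show ?thesis using that by blast
qed

lemma eventually_power_le_floor_phi:
  assumes "(y, z) \<in> Theta"
  shows "eventually (\<lambda>M. M ^ K \<le> nat \<lfloor>phi y z (real M)\<rfloor>) sequentially"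
proof -
  have "filterlim real at_top sequentially" by real_asymp
  from eventually_compose_filterlim[OF eventually_phi_ge_powr[OF assms, of "real K"] this]
  show ?thesis using eventually_gt_at_top[of 0]
  proof eventually_elim
    case (elim M)
    then have "real (M ^ K) \<le> phi y z (real M)" by (simp add: powr_realpow)
    then show ?case by (simp add: le_nat_floor)
  qed
qed

text \<open>Consecutive values of \<open>phi\<close> eventually have ratio at most 3/2; the slack up
  to 2 absorbs rounding.\<close>

lemma eventually_expo_near:
  assumes "(y, z) \<in> Theta"
  shows "eventually (\<lambda>x. \<exists>m. expo y z m \<le> x \<and> x \<le> 2 * expo y z m) sequentially"
proof -
  have "eventually (\<lambda>R. phi y z (R + 1) \<le> phi y z R * (1 + R powr (- 1 + 1 / 2)) \<and> R powr 1 \<le> phi y z R) at_top"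
    by (intro eventually_conj eventually_phi_Suc_le eventually_phi_ge_powr assms) auto
  then obtain R0 where R0: "\<And>R. R \<ge> R0 \<Longrightarrow> phi y z (R + 1) \<le> phi y z R * (1 + R powr (- 1 + 1 / 2))"
    "\<And>R. R \<ge> R0 \<Longrightarrow> R powr 1 \<le> phi y z R"
    unfolding eventually_at_top_linorder by blast
  define m0 where "m0 = nat \<lceil>R0\<rceil> + 4"
  show ?thesis using eventually_ge_at_top[of "expo y z m0"]
  proof eventually_elim
    case (elim x)
    obtain m where m: "m \<ge> m0" "expo y z m \<le> x" "x < expo y z (Suc m)"
      using expo_bracket[OF assms elim] by blast
    define R where "R = real (m + 3)"
    have R: "R \<ge> R0" "R \<ge> 4" using m(1) unfolding R_def m0_def by linarith+
    \<comment> \<open>The summand 4 in \<open>m0\<close> guarantees \<open>R \<ge> 4\<close>, which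
      makes this power at most 1/2.\<close>
    have "R powr (- 1 + 1 / 2) \<le> 4 powr (- 1 + 1 / 2)" using R by (intro powr_mono2') auto
    also have "(4 :: real) powr (- 1 + 1 / 2) = 1 / 2"
      using powr_half_sqrt[of 4] by (simp add: powr_minus_divide)
    finally have "1 + R powr (- 1 + 1 / 2) \<le> 3 / 2" by simp
    then have "phi y z R * (1 + R powr (- 1 + 1 / 2)) \<le> phi y z R * (3 / 2)"
      by (intro mult_left_mono) (auto simp: less_imp_le)
    then have "phi y z (R + 1) \<le> 3 / 2 * phi y z R" using R0(1)[OF R(1)] by linarith
    moreover have "real (expo y z (Suc m)) \<le> phi y z (R + 1)"
      using expo_le[of y z "Suc m"] by (simp add: R_def algebra_simps)
    moreover have "phi y z R < real (expo y z m) + 1" using expo_gt unfolding R_def .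
    moreover have "R \<le> phi y z R" using R0(2)[OF R(1)] R by simp
    ultimately have "real x \<le> 2 * real (expo y z m)" using m R by linarith
    then show ?case using m(2) by (intro exI[of _ m]) linarith
  qed
qed

text \<open>Two regimes: a small \<open>x\<close> is approximated by 0, with error below the first
  bound. Any other \<open>x\<close> lies beyond \<open>phi\<close> at
  \<open>M powr (1 - \<delta>)\<close>, so the exponent just below it has a large index, where
  relative gaps are small.\<close>

lemma eventually_expo_dense:
  assumes "(y, z) \<in> Theta" "0 < \<epsilon>" "\<epsilon> < 1"
  shows "eventually (\<lambda>M. \<forall>x \<le> nat \<lfloor>phi y z (real M)\<rfloor>. \<exists>s\<in>insert 0 (range (expo y z)). s \<le> x \<and>
    real (x - s) \<le> max (real (nat \<lfloor>phi y z (real M)\<rfloor>) / real M ^ K) (real x / real M powr (1 - \<epsilon>))) sequentially"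
proof -
  \<comment> \<open>One loss of \<open>\<delta>\<close> comes from the lower bound on the index and
    one from the gap estimate; \<open>(1 - \<delta>) * (1 - \<delta>) > 1 - \<epsilon>\<close>
    leaves room for constants.\<close>
  define \<delta> where "\<delta> = \<epsilon> / 4"
  have \<delta>: "0 < \<delta>" "\<delta> < 1" using assms by (simp_all add: \<delta>_def)
  have "eventually (\<lambda>R. phi y z (R + 1) \<le> phi y z R * (1 + R powr (- 1 + \<delta>)) \<and> (\<forall>R'\<ge>R. phi y z R \<le> phi y z R')) at_top"
    using eventually_phi_Suc_le[OF \<delta>] eventually_phi_mono[OF assms(1)]
    by eventually_elim auto
  then obtain R0 where R0: "\<And>R. R \<ge> R0 \<Longrightarrow> phi y z (R + 1) \<le> phi y z R * (1 + R powr (- 1 + \<delta>))"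
    "\<And>R R'. R \<ge> R0 \<Longrightarrow> R' \<ge> R \<Longrightarrow> phi y z R \<le> phi y z R'"
    unfolding eventually_at_top_linorder by blast
  define m0 where "m0 = nat \<lceil>R0\<rceil>"
  have real_top: "filterlim real at_top sequentially" by real_asymp
  have 1: "eventually (\<lambda>M. phi y z (real M powr (1 - \<delta>)) * real M powr real (K + 1) \<le> phi y z (real M)) sequentially"
    by (rule eventually_compose_filterlim[OF eventually_phi_powr_le[OF assms(1) \<delta>] real_top])
  \<comment> \<open>The leading 2 comes from \<open>phi y z R \<le> 2 * real x\<close>, the inner
    division by 2 from passing from \<open>R + 1\<close> to \<open>R\<close>, and
    \<open>1 / real M\<close> from rounding.\<close>
  have 2: "eventually (\<lambda>M. 2 * (real M powr (1 - \<delta>) / 2) powr (- 1 + \<delta>) + 1 / real M \<le> 1 / real M powr (1 - \<epsilon>)) sequentially"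
  proof -
    define a b where "a = (1 - \<delta>) * (1 - \<delta>)" and "b = 1 - \<epsilon>"
    have ab: "b < a" "0 < b" "a < 1"
      using assms(2,3) mult_strict_mono[of "1 - \<delta>" 1 "1 - \<delta>" 1]
      by (auto simp: a_def b_def \<delta>_def algebra_simps) (auto simp: add_pos_nonneg)
    have "eventually (\<lambda>M. 4 * real M powr (- a) + 1 / real M \<le> 1 / real M powr b) sequentially"
      using ab by real_asymp
    then show ?thesis
    proof eventually_elim
      case (elim M)
      have exponent: "(1 - \<delta>) * (\<delta> - 1) = - a" by (simp add: a_def algebra_simps)
      have "2 powr (- 1 + \<delta>) = 1 / 2 powr (1 - \<delta>)" using powr_minus_divide[of 2 "1 - \<delta>"] by simp
      then have "(real M powr (1 - \<delta>) / 2) powr (- 1 + \<delta>) = real M powr (- a) * 2 powr (1 - \<delta>)"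
        by (simp add: powr_divide powr_powr exponent)
      also have "\<dots> \<le> real M powr (- a) * 2 powr 1"
        using \<delta> by (intro mult_left_mono powr_mono) auto
      finally show ?case using elim by (simp add: b_def)
    qed
  qed
  have 3: "eventually (\<lambda>M. real M powr (1 - \<delta>) \<ge> 2) sequentially"
    using \<delta> by real_asymp
  show ?thesis
    using 1 2 3 eventually_power_le_floor_phi[OF assms(1), of "K + 1"] eventually_ge_at_top[of "expo y z m0"]
      eventually_ge_at_top[of 2]
  proof eventually_elim
    case (elim M)
    define N where "N = nat \<lfloor>phi y z (real M)\<rfloor>"
    have N: "phi y z (real M) < real N + 1" using phi_pos[of y z "real M"] unfolding N_def by linarith
    have N_ge: "real M * real M ^ K \<le> real N"
      using elim(4) unfolding N_def [symmetric] by (metis of_nat_le_iff of_nat_power power_Suc Suc_eq_plus1)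
    have MK: "real M ^ K \<ge> 1" using elim by (intro one_le_power) auto
    then have MK': "real M ^ K > 0" by linarith
    have "\<exists>s\<in>insert 0 (range (expo y z)). s \<le> x \<and>
        real (x - s) \<le> max (real N / real M ^ K) (real x / real M powr (1 - \<epsilon>))" if "x \<le> N" for x
    proof (cases "real x \<le> real N / real M ^ K")
      case True
      then show ?thesis by (intro bexI[of _ 0]) (auto simp: le_max_iff_disj)
    next
      case False
      then have x: "real N / real M ^ K < real x" by simp
      moreover have "real M \<le> real N / real M ^ K" using N_ge by (simp only: pos_le_divide_eq[OF MK'])
      ultimately have xM: "real M \<le> real x" by linarith
      then have "expo y z m0 \<le> x" using elim(5) by simp
      then obtain m where m: "m \<ge> m0" "expo y z m \<le> x" "x < expo y z (Suc m)"
        using expo_bracket[OF assms(1)] by blast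
      define R where "R = real (m + 3)"
      have R: "R \<ge> R0" "R \<ge> 1" using m(1) unfolding R_def m0_def by linarith+
      have x_lt: "real x < phi y z (R + 1)"
        using expo_le[of y z "Suc m"] m(3) by (simp add: R_def algebra_simps)
      \<comment> \<open>Otherwise \<open>x * M ^ K * M\<close> would be at most
        \<open>phi y z M\<close>, so \<open>x \<le> N / M ^ K\<close>, the case already excluded.
        The exponent \<open>K + 1\<close> supplies one factor \<open>M\<close> to swallow the
        rounding in \<open>N + 1\<close>.\<close>
      have "R + 1 \<ge> real M powr (1 - \<delta>)"
      proof (rule ccontr)
        assume "\<not> ?thesis"
        then have "real x < phi y z (real M powr (1 - \<delta>))"
          using x_lt R0(2)[of "R + 1" "real M powr (1 - \<delta>)"] R by simp
        then have "real x * (real M * real M ^ K) \<le> phi y z (real M powr (1 - \<delta>)) * (real M * real M ^ K)"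
          by (intro mult_right_mono) auto
        also have "\<dots> \<le> phi y z (real M)" using elim(1,6) powr_realpow[of "real M" "K + 1"] by simp
        also have "\<dots> \<le> real N + 1" using N by simp
        also have "\<dots> \<le> real N * real M"
        proof -
          have "real N * 2 \<le> real N * real M" using elim(6) by (intro mult_left_mono) auto
          moreover have "2 * 1 \<le> real M * real M ^ K" using MK elim(6) by (intro mult_mono) auto
          then have "real N \<ge> 1" using N_ge by linarith
          ultimately show ?thesis by linarith
        qed
        finally have "real x * real M ^ K * real M \<le> real N * real M" by (simp add: mult_ac)
        then have "real x * real M ^ K \<le> real N" using elim(6) by simp
        then show False using x unfolding pos_divide_less_eq[OF MK'] by linarith
      qed
      then have R_ge: "R \<ge> real M powr (1 - \<delta>) / 2" using elim(3) by linarith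
      have "phi y z R < real (expo y z m) + 1" using expo_gt unfolding R_def .
      moreover have "real (expo y z m) \<le> real x" using m(2) by simp
      ultimately have phi_R: "phi y z R \<le> 2 * real x" "phi y z R \<le> real (expo y z m) + 1"
        using xM elim(6) by linarith+
      have "real x - real (expo y z m) \<le> phi y z R * R powr (- 1 + \<delta>) + 1"
        using x_lt R0(1)[OF R(1)] phi_R(2) by (simp add: algebra_simps)
      also have "phi y z R * R powr (- 1 + \<delta>) \<le> 2 * real x * (real M powr (1 - \<delta>) / 2) powr (- 1 + \<delta>)"
        using phi_R R_ge elim(6) \<delta> by (intro mult_mono powr_mono2') auto
      also have "2 * real x * (real M powr (1 - \<delta>) / 2) powr (- 1 + \<delta>) + 1
          \<le> real x * (2 * (real M powr (1 - \<delta>) / 2) powr (- 1 + \<delta>) + 1 / real M)"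
        using xM elim(6) by (simp add: field_simps)
      also have "\<dots> \<le> real x * (1 / real M powr (1 - \<epsilon>))"
        using elim(2) by (intro mult_left_mono) auto
      finally have "real x - real (expo y z m) \<le> real x / real M powr (1 - \<epsilon>)" by simp
      then show ?thesis using m(2) by (intro bexI[of _ "expo y z m"]) (auto simp: of_nat_diff le_max_iff_disj)
    qed
    then show ?case unfolding N_def by blast
  qed
qed

section \<open>Integer power series vanishing at the inverse of a Pisot or Salem number\<close>

definition nonneg_fps :: "int fps \<Rightarrow> bool" where
  "nonneg_fps F \<longleftrightarrow> (\<forall>n. fps_nth F n \<ge> 0)"

definition fps_supp :: "int fps \<Rightarrow> nat set" where
  "fps_supp F = {n. fps_nth F n \<noteq> 0}"

definition psum :: "int fps \<Rightarrow> nat \<Rightarrow> int" where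
  "psum F N = (\<Sum>n\<le>N. fps_nth F n)"

definition real_fps :: "int fps \<Rightarrow> real fps" where
  "real_fps F = Abs_fps (\<lambda>n. real_of_int (fps_nth F n))"

lemma real_fps_nth [simp]: "fps_nth (real_fps F) n = real_of_int (fps_nth F n)"
  by (simp add: real_fps_def)

lemma real_fps_mult: "real_fps (F * G) = real_fps F * real_fps G"
  by (intro fps_ext) (simp add: fps_mult_nth)

lemma real_fps_one: "real_fps 1 = 1"
  by (intro fps_ext) simp

lemma real_fps_power: "real_fps (F ^ k) = real_fps F ^ k"
  by (induction k) (simp_all add: real_fps_mult real_fps_one)

lemma real_fps_const: "real_fps (fps_const a) = fps_const (real_of_int a)"
  by (intro fps_ext) simp

lemma nonneg_fps_one: "nonneg_fps 1"
  by (simp add: nonneg_fps_def)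

lemma nonneg_fps_mult: "nonneg_fps F \<Longrightarrow> nonneg_fps G \<Longrightarrow> nonneg_fps (F * G)"
  by (auto simp: nonneg_fps_def fps_mult_nth intro!: sum_nonneg)

lemma nonneg_fps_power: "nonneg_fps F \<Longrightarrow> nonneg_fps (F ^ k)"
  by (induction k) (simp_all add: nonneg_fps_one nonneg_fps_mult)

lemma fps_mult_nth_ge:
  assumes "nonneg_fps F" "nonneg_fps G"
  shows "fps_nth F a * fps_nth G b \<le> fps_nth (F * G) (a + b)"
proof -
  have "fps_nth F a * fps_nth G (a + b - a) \<le> (\<Sum>i=0..a+b. fps_nth F i * fps_nth G (a + b - i))"
    using assms by (intro member_le_sum) (auto simp: nonneg_fps_def)
  then show ?thesis by (simp add: fps_mult_nth)
qed

lemma fps_supp_mult: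
  assumes "nonneg_fps F" "nonneg_fps G" "a \<in> fps_supp F" "b \<in> fps_supp G"
  shows "a + b \<in> fps_supp (F * G)"
proof -
  have "fps_nth F a > 0" "fps_nth G b > 0"
    using assms by (auto simp: nonneg_fps_def fps_supp_def order_less_le)
  then have "fps_nth (F * G) (a + b) > 0"
    using fps_mult_nth_ge[OF assms(1,2), of a b] by (smt (verit) mult_pos_pos)
  then show ?thesis by (simp add: fps_supp_def)
qed

lemma fps_supp_mult_left:
  assumes "nonneg_fps F" "nonneg_fps G" "0 \<in> fps_supp G"
  shows "fps_supp F \<subseteq> fps_supp (F * G)"
  using fps_supp_mult[OF assms(1,2) _ assms(3)] by auto

text \<open>The quotient of the two monomials has a nonzero constant term, and nonnegativity
  excludes cancellation. Thus the support of one large monomial covers those of all smaller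
  ones.\<close>

lemma fps_supp_monomial_mono:
  assumes "nonneg_fps F" "nonneg_fps G" "0 \<in> fps_supp F" "0 \<in> fps_supp G" "i \<le> i'" "j \<le> j'"
  shows "fps_supp (F ^ i * G ^ j) \<subseteq> fps_supp (F ^ i' * G ^ j')"
proof -
  have "F ^ i' * G ^ j' = F ^ i * G ^ j * (F ^ (i' - i) * G ^ (j' - j))"
    using assms(5,6) by (simp add: mult_ac flip: power_add)
  moreover have "0 \<in> fps_supp (F ^ (i' - i) * G ^ (j' - j))"
    using assms by (auto simp: fps_supp_def)
  ultimately show ?thesis
    using assms by (metis fps_supp_mult_left nonneg_fps_mult nonneg_fps_power)
qed

lemma psum_nonneg: "nonneg_fps F \<Longrightarrow> psum F N \<ge> 0"
  by (auto simp: psum_def nonneg_fps_def intro: sum_nonneg)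

lemma psum_ge_1:
  assumes "nonneg_fps F" "0 \<in> fps_supp F"
  shows "psum F N \<ge> 1"
proof -
  have "fps_nth F 0 \<le> psum F N" unfolding psum_def
    using assms by (intro member_le_sum) (auto simp: nonneg_fps_def)
  moreover have "fps_nth F 0 \<ge> 0" using assms(1) by (auto simp: nonneg_fps_def)
  ultimately show ?thesis using assms(2) by (simp add: fps_supp_def)
qed

lemma psum_mult_le:
  assumes "nonneg_fps F" "nonneg_fps G"
  shows "psum (F * G) N \<le> psum F N * psum G N"
proof -
  have "psum (F * G) N = (\<Sum>n\<le>N. \<Sum>i\<le>n. fps_nth F i * fps_nth G (n - i))"
    by (simp add: psum_def fps_mult_nth atLeast0AtMost)
  also have "\<dots> = (\<Sum>(i, j)\<in>{(i, j). i + j \<le> N}. fps_nth F i * fps_nth G j)"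
    by (rule sum.triangle_reindex_eq [symmetric])
  also have "\<dots> \<le> (\<Sum>(i, j)\<in>{..N} \<times> {..N}. fps_nth F i * fps_nth G j)"
    using assms by (intro sum_mono2) (auto simp: nonneg_fps_def)
  also have "\<dots> = psum F N * psum G N"
    by (simp add: psum_def sum_product sum.cartesian_product)
  finally show ?thesis .
qed

lemma psum_power_le:
  assumes "nonneg_fps F"
  shows "psum (F ^ k) N \<le> psum F N ^ k"
proof (induction k)
  case 0
  have "psum 1 N = (\<Sum>n\<le>N. if n = 0 then 1 else 0)"
    unfolding psum_def by (intro sum.cong) auto
  then show ?case by simp
next
  case (Suc k)
  have "psum (F ^ Suc k) N \<le> psum F N * psum (F ^ k) N"
    using psum_mult_le[OF assms nonneg_fps_power[OF assms]] by simp
  also have "\<dots> \<le> psum F N * psum F N ^ k"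
    using Suc psum_nonneg[OF assms] by (intro mult_left_mono)
  finally show ?case by simp
qed

lemma psum_monomial_le:
  assumes "nonneg_fps F" "nonneg_fps G"
  shows "psum (F ^ i * G ^ j) N \<le> psum F N ^ i * psum G N ^ j"
proof -
  have "psum (F ^ i * G ^ j) N \<le> psum (F ^ i) N * psum (G ^ j) N"
    by (intro psum_mult_le nonneg_fps_power assms)
  also have "\<dots> \<le> psum F N ^ i * psum G N ^ j"
    using assms by (intro mult_mono psum_power_le psum_nonneg nonneg_fps_power zero_le_power)
  finally show ?thesis .
qed

lemma card_fps_supp_le:
  assumes "nonneg_fps F"
  shows "int (card (fps_supp F \<inter> {..N})) \<le> psum F N"
proof -
  have "int (card (fps_supp F \<inter> {..N})) = (\<Sum>n\<in>fps_supp F \<inter> {..N}. 1)" by simp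
  also have "\<dots> \<le> (\<Sum>n\<in>fps_supp F \<inter> {..N}. fps_nth F n)"
  proof (intro sum_mono)
    fix n assume "n \<in> fps_supp F \<inter> {..N}"
    then have "fps_nth F n \<noteq> 0" "fps_nth F n \<ge> 0" using assms by (auto simp: fps_supp_def nonneg_fps_def)
    then show "1 \<le> fps_nth F n" by linarith
  qed
  also have "\<dots> \<le> psum F N"
    unfolding psum_def using assms by (intro sum_mono2) (auto simp: nonneg_fps_def)
  finally show ?thesis .
qed

section \<open>Partial sums of a vanishing integer power series\<close>

lemma summable_real_fps:
  assumes "fps_conv_radius (real_fps c) \<ge> 1" "0 \<le> Y" "Y < 1"
  shows "summable (\<lambda>n. \<bar>real_of_int (fps_nth c n)\<bar> * Y ^ n)"
proof -
  have "ereal (norm Y) < 1" using assms by simp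
  then have "ereal (norm Y) < fps_conv_radius (real_fps c)" using assms(1) by (rule less_le_trans)
  then have "summable (\<lambda>n. norm (fps_nth (real_fps c) n * Y ^ n))"
    unfolding fps_conv_radius_def by (rule abs_summable_in_conv_radius)
  then show ?thesis using assms by (simp add: abs_mult)
qed

text \<open>If the partial sums \<open>W u\<close> of \<open>\<Sum>n. c n * \<beta> powi (- n) = 0\<close> do not vanish, then
  \<open>\<beta> ^ u * W u\<close>, an element of \<open>\<int>[\<beta>]\<close> all of whose conjugates are small, determines \<open>u\<close> up to
  the value of \<open>\<Sum>n\<le>u. \<bar>c n\<bar>\<close>: when the latter does not increase, \<open>W\<close> stays constant.\<close>

lemma card_nonzero_partial_sums:
  fixes c :: "int fps" and \<beta> :: real
  assumes \<beta>: "pisot \<beta> \<or> salem \<beta>"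
    and conv: "fps_conv_radius (real_fps c) \<ge> 1"
    and zero: "eval_fps (real_fps c) (inverse \<beta>) = 0"
  defines "W \<equiv> \<lambda>u. \<Sum>n\<le>u. real_of_int (fps_nth c n) * inverse \<beta> ^ n"
  obtains C D :: nat where
    "\<And>N. card {u. 2 * u \<le> N \<and> W u \<noteq> 0} \<le> C * nat (1 + (\<Sum>n\<le>N. \<bar>fps_nth c n\<bar>)) ^ D"
proof -
  have \<beta>1: "\<beta> > 1" using \<beta> by (auto simp: pisot_def salem_def)
  define X where "X = inverse \<beta>"
  \<comment> \<open>The series still converges absolutely at \<open>Y\<close>, and
    \<open>X ^ (n - u) \<le> Y ^ n\<close> as soon as \<open>n \<ge> 2 * u\<close>. This bounds the
    tail beyond \<open>N\<close> independently of \<open>u\<close> and \<open>N\<close>.\<close>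
  define Y where "Y = sqrt X"
  have X: "0 < X" "X < 1" "X * \<beta> = 1" using \<beta>1 by (auto simp: X_def inverse_less_1_iff)
  have Y: "0 < Y" "Y < 1" "Y ^ 2 = X" using X by (auto simp: Y_def)
  have cX: "(\<lambda>n. real_of_int (fps_nth c n) * X ^ n) sums 0"
  proof -
    have "summable (\<lambda>n. norm (real_of_int (fps_nth c n) * X ^ n))"
      using summable_real_fps[OF conv, of X] X by (simp add: abs_mult)
    then have "summable (\<lambda>n. real_of_int (fps_nth c n) * X ^ n)" by (rule summable_norm_cancel)
    then show ?thesis
      using zero by (simp add: sums_iff eval_fps_def X_def)
  qed
  have cY: "summable (\<lambda>n. \<bar>real_of_int (fps_nth c n)\<bar> * Y ^ n)"
    using Y by (intro summable_real_fps conv) auto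
  define T where "T = nat \<lceil>\<Sum>n. \<bar>real_of_int (fps_nth c n)\<bar> * Y ^ n\<rceil>"
  have T: "(\<Sum>n. \<bar>real_of_int (fps_nth c n)\<bar> * Y ^ n) \<le> real T" unfolding T_def by linarith
  define S where "S N = nat (\<Sum>n\<le>N. \<bar>fps_nth c n\<bar>)" for N
  have S: "real (S N) = (\<Sum>n\<le>N. \<bar>real_of_int (fps_nth c n)\<bar>)" for N
  proof -
    have "int (S N) = (\<Sum>n\<le>N. \<bar>fps_nth c n\<bar>)" unfolding S_def by (simp add: sum_nonneg)
    then have "real_of_int (int (S N)) = real_of_int (\<Sum>n\<le>N. \<bar>fps_nth c n\<bar>)" by (rule arg_cong)
    then show ?thesis by simp
  qed
  have S_mono: "S u \<le> S N" if "u \<le> N" for u N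
    unfolding S_def using that by (intro nat_mono sum_mono2) auto
  \<comment> \<open>Horner recursion for the truncated series with reversed coefficients; it
    exhibits \<open>\<beta> ^ u * W u\<close> as an element of
    \<open>\<int>[\<beta>]\<close>.\<close>
  define q where "q = rec_nat [:fps_nth c 0:] (\<lambda>u p. pCons (fps_nth c (Suc u)) p)"
  have q_eval: "poly (map_poly of_int (q u)) z = (\<Sum>n\<le>u. of_int (fps_nth c n) * z ^ (u - n))"
    for u and z :: "'a :: field_char_0"
  proof (induction u)
    case (Suc u)
    have "(\<Sum>n\<le>u. of_int (fps_nth c n) * z ^ (Suc u - n)) = z * (\<Sum>n\<le>u. of_int (fps_nth c n) * z ^ (u - n))"
      unfolding sum_distrib_left by (intro sum.cong) (auto simp: Suc_diff_le mult_ac)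
    then show ?case using Suc by (simp add: q_def map_poly_pCons)
  qed (simp add: q_def map_poly_pCons)
  define Z where "Z u = \<beta> ^ u * W u" for u
  have Z: "Z u = poly (map_poly of_int (q u)) \<beta>" for u
  proof -
    have "\<beta> ^ u * X ^ n = \<beta> ^ (u - n)" if "n \<le> u" for n
      using that \<beta>1 by (simp add: X_def power_diff field_simps)
    then show ?thesis
      unfolding Z_def W_def q_eval sum_distrib_left X_def [symmetric]
      by (intro sum.cong) (auto simp: mult.left_commute)
  qed
  have q_small: "norm (poly (map_poly of_int (q u)) z) \<le> real (S u)" if "norm z \<le> 1" for u and z :: complex
  proof -
    have "norm (poly (map_poly of_int (q u)) z) \<le> (\<Sum>n\<le>u. norm (of_int (fps_nth c n) * z ^ (u - n)))"
      unfolding q_eval by (rule norm_sum)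
    also have "\<dots> \<le> (\<Sum>n\<le>u. \<bar>real_of_int (fps_nth c n)\<bar>)"
      using that by (intro sum_mono) (auto simp: norm_mult norm_power mult_left_le power_le_one)
    finally show ?thesis by (simp add: S)
  qed
  have Z_small: "\<bar>Z u\<bar> \<le> real (S N + T)" if "2 * u \<le> N" for u N
  proof -
    \<comment> \<open>The whole series vanishes, so \<open>- Z u\<close> equals the tail after
      \<open>u\<close>, scaled by \<open>\<beta> ^ u\<close>. The majorant \<open>h\<close> uses the
      coefficients alone up to \<open>N\<close> and the convergent series at \<open>Y\<close>
      beyond.\<close>
    define f where "f n = \<beta> ^ u * (real_of_int (fps_nth c n) * X ^ n)
      - (if n \<in> {..u} then \<beta> ^ u * (real_of_int (fps_nth c n) * X ^ n) else 0)" for n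
    define h where "h n = (if n \<in> {..N} then \<bar>real_of_int (fps_nth c n)\<bar> else 0)
      + \<bar>real_of_int (fps_nth c n)\<bar> * Y ^ n" for n
    have "f sums (\<beta> ^ u * 0 - (\<Sum>n\<in>{..u}. \<beta> ^ u * (real_of_int (fps_nth c n) * X ^ n)))"
      unfolding f_def by (intro sums_diff sums_mult cX sums_If_finite_set) auto
    then have f: "f sums (- Z u)"
      by (simp add: Z_def W_def X_def sum_distrib_left)
    have h: "h sums ((\<Sum>n\<in>{..N}. \<bar>real_of_int (fps_nth c n)\<bar>) + (\<Sum>n. \<bar>real_of_int (fps_nth c n)\<bar> * Y ^ n))"
      unfolding h_def by (intro sums_add sums_If_finite_set summable_sums cY) auto
    have "norm (f n) \<le> h n" for n
    proof (cases "n \<le> u")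
      case True
      then show ?thesis using Y by (auto simp: f_def h_def)
    next
      case False
      have "\<beta> ^ u * X ^ n = X ^ (n - u)"
        using False \<beta>1 by (simp add: X_def power_diff field_simps)
      then have fn: "norm (f n) = \<bar>real_of_int (fps_nth c n)\<bar> * X ^ (n - u)"
        using False X \<beta>1 by (simp add: f_def abs_mult mult.left_commute)
      show ?thesis
      proof (cases "n \<le> N")
        case True
        have "\<bar>real_of_int (fps_nth c n)\<bar> * X ^ (n - u) \<le> \<bar>real_of_int (fps_nth c n)\<bar> * 1"
          using X by (intro mult_left_mono power_le_one) auto
        moreover have "\<bar>real_of_int (fps_nth c n)\<bar> * Y ^ n \<ge> 0" using Y by auto
        ultimately show ?thesis using True unfolding fn h_def by simp
      next
        case n: False
        have "X ^ (n - u) = Y ^ (2 * (n - u))" by (simp add: power_mult Y)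
        also have "\<dots> \<le> Y ^ n" using that n Y by (intro power_decreasing) auto
        finally show ?thesis using n unfolding fn h_def by (simp add: mult_left_mono)
      qed
    qed
    then have "norm (suminf f) \<le> suminf h"
      using h by (intro norm_suminf_le) (auto simp: sums_iff)
    then show ?thesis using f h T S[of N] by (simp add: sums_iff)
  qed
  obtain C d :: nat where C:
    "\<And>H. H \<ge> 1 \<Longrightarrow> finite (bounded_values \<beta> H) \<and> card (bounded_values \<beta> H) \<le> C * H ^ d"
    using card_bounded_values[OF \<beta>] by blast
  have "card {u. 2 * u \<le> N \<and> W u \<noteq> 0} \<le> C * (T + 1) ^ d * nat (1 + (\<Sum>n\<le>N. \<bar>fps_nth c n\<bar>)) ^ (d + 1)" for N
  proof -
    let ?U = "{u. 2 * u \<le> N \<and> W u \<noteq> 0}"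
    define H where "H = S N + T + 1"
    have "inj_on (\<lambda>u. (S u, Z u)) ?U"
    proof (rule linorder_inj_onI)
      fix u v assume uv: "u < v" "u \<in> ?U" "v \<in> ?U"
      show "(S u, Z u) \<noteq> (S v, Z v)"
      proof
        assume eq: "(S u, Z u) = (S v, Z v)"
        have split: "{..v} = {..u} \<union> {u<..v}" "{..u} \<inter> {u<..v} = {}" using uv(1) by auto
        have "real (S v) = real (S u) + (\<Sum>n\<in>{u<..v}. \<bar>real_of_int (fps_nth c n)\<bar>)"
          unfolding S split(1) by (intro sum.union_disjoint) auto
        then have "(\<Sum>n\<in>{u<..v}. \<bar>real_of_int (fps_nth c n)\<bar>) = 0" using eq by simp
        then have c0: "fps_nth c n = 0" if "n \<in> {u<..v}" for n
          using that by (subst (asm) sum_nonneg_eq_0_iff) auto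
        have "W v = W u + (\<Sum>n\<in>{u<..v}. real_of_int (fps_nth c n) * inverse \<beta> ^ n)"
          unfolding W_def split(1) by (intro sum.union_disjoint) auto
        then have "W v = W u" using c0 by simp
        then have "\<beta> ^ u * W v = \<beta> ^ v * W v" using eq by (simp add: Z_def)
        then have "\<beta> ^ u = \<beta> ^ v" using uv by simp
        then show False using uv(1) \<beta>1 power_strict_increasing[of u v \<beta>] by simp
      qed
    qed auto
    moreover have "(\<lambda>u. (S u, Z u)) ` ?U \<subseteq> {..S N} \<times> bounded_values \<beta> H"
    proof safe
      fix u assume u: "2 * u \<le> N"
      then show "S u \<le> S N" by (intro S_mono) auto
      show "Z u \<in> bounded_values \<beta> H"
        unfolding bounded_values_def
      proof (intro CollectI exI[of _ "q u"] conjI allI impI)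
        show "\<bar>poly (map_poly of_int (q u)) \<beta>\<bar> \<le> real H"
          using Z_small[OF u] by (simp add: Z H_def)
        fix z :: complex assume "norm z \<le> 1"
        then have "norm (poly (map_poly of_int (q u)) z) \<le> real (S u)" by (rule q_small)
        also have "\<dots> \<le> real H" using S_mono[of u N] u by (simp add: H_def)
        finally show "norm (poly (map_poly of_int (q u)) z) \<le> real H" .
      qed (rule Z)
    qed
    moreover have H: "finite (bounded_values \<beta> H) \<and> card (bounded_values \<beta> H) \<le> C * H ^ d"
      by (rule C) (simp add: H_def)
    ultimately have "card ?U \<le> card ({..S N} \<times> bounded_values \<beta> H)"
      by (intro card_inj_on_le) auto
    also have "\<dots> \<le> (S N + 1) * (C * H ^ d)"
      unfolding card_cartesian_product using H by (intro mult_mono) auto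
    also have "\<dots> \<le> (S N + 1) * (C * ((T + 1) * (S N + 1)) ^ d)"
      by (intro mult_left_mono power_mono) (auto simp: H_def algebra_simps)
    also have "\<dots> = C * (T + 1) ^ d * (S N + 1) ^ (d + 1)"
      unfolding power_mult_distrib by (simp add: algebra_simps)
    also have "S N + 1 = nat (1 + (\<Sum>n\<le>N. \<bar>fps_nth c n\<bar>))"
      unfolding S_def by (subst nat_add_distrib) (auto simp: sum_nonneg)
    finally show ?thesis .
  qed
  then show ?thesis using that by blast
qed

section \<open>Gaps in the support of the top monomial\<close>

text \<open>A point up to \<open>N div 2\<close> at which no suitable gap ends is either less than
  \<open>L\<close> past a point of \<open>A\<close> or at most \<open>G\<close> past a point of
  \<open>B\<close>. Such points are too few to cover the range.\<close>

lemma gap_exists: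
  fixes A B :: "nat set"
  assumes near: "\<And>x. x \<le> N \<Longrightarrow> \<exists>a\<in>A. a \<le> x \<and> x - a \<le> G"
    and few: "2 * (card (B \<inter> {..N}) * (G + 1) + card (A \<inter> {..N}) * L) < N"
  obtains a x where "2 * x \<le> N" "a \<in> A" "a + L \<le> x" "\<And>n. a < n \<Longrightarrow> n \<le> x \<Longrightarrow> n \<notin> A \<and> n \<notin> B"
proof (rule ccontr)
  note witness = that
  assume no: "\<not> thesis"
  have "{..N div 2} \<subseteq> (\<Union>b\<in>B \<inter> {..N}. {b..<b + (G + 1)}) \<union> (\<Union>a\<in>A \<inter> {..N}. {a..<a + L})"
  proof
    fix x assume "x \<in> {..N div 2}"
    then have x: "2 * x \<le> N" by auto
    then obtain a' where a': "a' \<in> A" "a' \<le> x" "x - a' \<le> G" using near[of x] by auto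
    define a where "a = Max (A \<inter> {..x})"
    have "a \<in> A \<inter> {..x}" unfolding a_def using a' by (intro Max_in) auto
    then have a: "a \<in> A" "a \<le> x" by auto
    have a_max: "n \<le> a" if "n \<in> A" "n \<le> x" for n
      unfolding a_def using that by (intro Max_ge) auto
    show "x \<in> (\<Union>b\<in>B \<inter> {..N}. {b..<b + (G + 1)}) \<union> (\<Union>a\<in>A \<inter> {..N}. {a..<a + L})"
    proof (cases "a + L \<le> x")
      case False
      then show ?thesis using a x by force
    next
      case True
      \<comment> \<open>The obstructing \<open>n\<close> exceeds the largest element
        \<open>a\<close> of \<open>A\<close> up to \<open>x\<close>, so it belongs to
        \<open>B\<close>; as it also exceeds \<open>a'\<close>, it is within \<open>G\<close> of
        \<open>x\<close>.\<close>
      obtain n where n: "a < n" "n \<le> x" "n \<in> A \<or> n \<in> B"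
        using witness[OF x a(1) True] no by blast
      then have "n \<in> B" using a_max[of n] by auto
      moreover have "x < n + (G + 1)" using n a_max[OF a'(1,2)] a' by linarith
      ultimately show ?thesis using n x by force
    qed
  qed
  then have "card {..N div 2} \<le> card ((\<Union>b\<in>B \<inter> {..N}. {b..<b + (G + 1)}) \<union> (\<Union>a\<in>A \<inter> {..N}. {a..<a + L}))"
    by (intro card_mono) auto
  also have "\<dots> \<le> card (\<Union>b\<in>B \<inter> {..N}. {b..<b + (G + 1)}) + card (\<Union>a\<in>A \<inter> {..N}. {a..<a + L})"
    by (rule card_Un_le)
  also have "\<dots> \<le> (\<Sum>b\<in>B \<inter> {..N}. card {b..<b + (G + 1)}) + (\<Sum>a\<in>A \<inter> {..N}. card {a..<a + L})"
    by (intro add_mono card_UN_le) auto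
  also have "\<dots> = card (B \<inter> {..N}) * (G + 1) + card (A \<inter> {..N}) * L" by simp
  finally show False using few by simp
qed

text \<open>Any \<open>s\<close> consecutive admissible indices contain a zero of the partial sums.
  One zero is found before \<open>t\<close> and one from \<open>t\<close> on; between them the sums
  cannot decrease and would strictly increase at \<open>t\<close>.\<close>

lemma zeros_not_separated:
  fixes c :: "int fps"
  assumes "X > 0" and few: "card {u. 2 * u \<le> N \<and> (\<Sum>n\<le>u. real_of_int (fps_nth c n) * X ^ n) \<noteq> 0} < s"
    and x: "2 * x \<le> N" "a + 2 * s \<le> x"
    and nonneg: "\<And>n. a < n \<Longrightarrow> n \<le> x \<Longrightarrow> fps_nth c n \<ge> 0"
    and t: "a + s \<le> t" "t + s \<le> x"
  shows "fps_nth c t = 0"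
proof (rule ccontr)
  assume ct: "fps_nth c t \<noteq> 0"
  define W where "W u = (\<Sum>n\<le>u. real_of_int (fps_nth c n) * X ^ n)" for u
  have fin: "finite {u. 2 * u \<le> N \<and> W u \<noteq> 0}"
    by (rule finite_subset[of _ "{..N}"]) auto
  \<comment> \<open>The last index of the window is \<open>b + s - 1\<close>, whence
    \<open>Suc x\<close>.\<close>
  have zero: "\<exists>u. b \<le> u \<and> u < b + s \<and> W u = 0" if "b + s \<le> Suc x" for b
  proof (rule ccontr)
    assume "\<not> ?thesis"
    then have "{b..<b + s} \<subseteq> {u. 2 * u \<le> N \<and> W u \<noteq> 0}" using that x by auto
    from card_mono[OF fin this] show False using few by (simp add: W_def)
  qed
  obtain u where u: "a \<le> u" "u < a + s" "W u = 0" using zero[of a] x by auto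
  obtain v where v: "t \<le> v" "v < t + s" "W v = 0" using zero[of t] t by auto
  have uv: "u < t" using u t by auto
  have "{..v} = {..u} \<union> {u<..v}" "{..u} \<inter> {u<..v} = {}" using uv v by auto
  then have "W v = W u + (\<Sum>n\<in>{u<..v}. real_of_int (fps_nth c n) * X ^ n)"
    unfolding W_def by (simp add: sum.union_disjoint)
  moreover have "(\<Sum>n\<in>{u<..v}. real_of_int (fps_nth c n) * X ^ n) > 0"
  proof (rule sum_pos2[of _ t])
    have "fps_nth c t \<ge> 0" using uv u v t by (intro nonneg) auto
    then show "0 < real_of_int (fps_nth c t) * X ^ t" using ct assms(1) by simp
  qed (use uv u v t nonneg assms(1) in auto)
  ultimately show False using u v by simp
qed

text \<open>Greedy approximation: each further factor \<open>F\<close> approximates what is left of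
  \<open>x\<close>, dividing the error by \<open>q\<close> until it reaches the floor
  \<open>\<delta>\<close>.\<close>

lemma dense_power:
  fixes F :: "int fps" and q \<delta> :: real
  assumes "nonneg_fps F" "q \<ge> 1" "\<delta> \<ge> 0"
    and dense: "\<And>x. x \<le> N \<Longrightarrow> \<exists>s\<in>fps_supp F. s \<le> x \<and> real (x - s) \<le> max \<delta> (real x / q)"
  shows "x \<le> N \<Longrightarrow> \<exists>a\<in>fps_supp (F ^ k). a \<le> x \<and> real (x - a) \<le> max \<delta> (real x / q ^ k)"
proof (induction k)
  case 0
  then show ?case by (intro bexI[of _ 0]) (auto simp: fps_supp_def)
next
  case (Suc k)
  then obtain a where a: "a \<in> fps_supp (F ^ k)" "a \<le> x" "real (x - a) \<le> max \<delta> (real x / q ^ k)" by auto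
  have "x - a \<le> N" using Suc.prems by simp
  from dense[OF this] obtain s where
    s: "s \<in> fps_supp F" "s \<le> x - a" "real (x - a - s) \<le> max \<delta> (real (x - a) / q)" by blast
  have "real (x - a) / q \<le> max \<delta> (real x / q ^ k) / q"
    using a assms by (intro divide_right_mono) auto
  also have "\<dots> = max (\<delta> / q) (real x / q ^ Suc k)"
    using assms by (simp add: max_divide_distrib_right mult.commute)
  also have "\<dots> \<le> max \<delta> (real x / q ^ Suc k)"
    using assms by (intro max.mono) (auto simp: divide_le_eq mult_left_le_one_le mult_le_cancel_left1)
  finally have "real (x - (s + a)) \<le> max \<delta> (real x / q ^ Suc k)"
    using s by (simp add: diff_diff_add add.commute)
  moreover have "s + a \<in> fps_supp (F ^ Suc k)"
    using fps_supp_mult[OF assms(1) nonneg_fps_power[OF assms(1)] s(1) a(1)] by simp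
  ultimately show ?case using a s by (intro bexI[of _ "s + a"]) auto
qed

section \<open>Nonvanishing of integer polynomials in two power series\<close>

lemma conv_radius_monomial:
  assumes "fps_conv_radius (real_fps F) \<ge> 1" "fps_conv_radius (real_fps G) \<ge> 1"
  shows "fps_conv_radius (real_fps (F ^ i * G ^ j)) \<ge> 1"
proof -
  have "fps_conv_radius (real_fps F ^ i) \<ge> 1" "fps_conv_radius (real_fps G ^ j) \<ge> 1"
    using assms fps_conv_radius_power order_trans by blast+
  then show ?thesis
    unfolding real_fps_mult real_fps_power using fps_conv_radius_mult[of "real_fps F ^ i" "real_fps G ^ j"]
    by (meson min.boundedI order_trans)
qed

lemma eval_fps_sum_mult_const:
  fixes f :: "'b \<Rightarrow> int fps" and X :: real
  assumes "finite S" "\<And>x. x \<in> S \<Longrightarrow> fps_conv_radius (real_fps (f x)) \<ge> 1" "\<bar>X\<bar> < 1"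
  shows "fps_conv_radius (real_fps (\<Sum>x\<in>S. fps_const (k x) * f x)) \<ge> 1 \<and>
    eval_fps (real_fps (\<Sum>x\<in>S. fps_const (k x) * f x)) X = (\<Sum>x\<in>S. real_of_int (k x) * eval_fps (real_fps (f x)) X)"
  using assms
proof (induction S rule: finite_induct)
  case empty
  have "real_fps 0 = 0" by (intro fps_ext) simp
  then show ?case by simp
next
  case (insert x S)
  let ?T = "\<Sum>x\<in>S. fps_const (k x) * f x"
  have add: "real_fps (F + G) = real_fps F + real_fps G" for F G by (intro fps_ext) simp
  have X: "ereal (norm X) < 1" using assms(3) by simp
  have fx: "fps_conv_radius (real_fps (f x)) \<ge> 1" using insert by simp
  have T: "fps_conv_radius (real_fps ?T) \<ge> 1"
    and evT: "eval_fps (real_fps ?T) X = (\<Sum>x\<in>S. real_of_int (k x) * eval_fps (real_fps (f x)) X)"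
    using insert by auto
  have kf: "real_fps (fps_const (k x) * f x) = fps_const (real_of_int (k x)) * real_fps (f x)"
    by (simp add: real_fps_mult real_fps_const)
  have kfr: "fps_conv_radius (real_fps (fps_const (k x) * f x)) \<ge> 1"
    unfolding kf using fps_conv_radius_mult[of "fps_const (real_of_int (k x))" "real_fps (f x)"] fx
    by (simp add: order_trans)
  have "fps_conv_radius (real_fps (fps_const (k x) * f x + ?T)) \<ge> 1"
    unfolding add using kfr T fps_conv_radius_add by (meson min.boundedI order_trans)
  moreover have "eval_fps (real_fps (fps_const (k x) * f x + ?T)) X
      = real_of_int (k x) * eval_fps (real_fps (f x)) X + eval_fps (real_fps ?T) X"
  proof -
    have inside: "ereal (norm X) < fps_conv_radius F" if "fps_conv_radius F \<ge> 1" for F :: "real fps"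
      using X that by (rule less_le_trans)
    have "eval_fps (real_fps (fps_const (k x) * f x)) X = real_of_int (k x) * eval_fps (real_fps (f x)) X"
      unfolding kf by (subst eval_fps_mult) (simp_all add: inside fx del: real_norm_def)
    then show ?thesis
      unfolding add by (subst eval_fps_add) (simp_all add: inside kfr T del: real_norm_def)
  qed
  ultimately show ?case using insert evT by simp
qed

text \<open>The argument in abstract form. Up to \<open>N\<close>, which exceeds any fixed power of
  \<open>M\<close>, \<open>F1\<close> has at most \<open>2 * M\<close> exponents and
  \<open>F2\<close> fewer than any fixed root of \<open>M\<close>. The pair \<open>(g, h)\<close> is
  lexicographically largest, with the power of \<open>F1\<close> first, since the exponents of
  \<open>F1\<close> are the plentiful ones.\<close>

lemma top_monomial_nonzero:
  fixes F1 F2 :: "int fps" and A :: "nat \<Rightarrow> nat \<Rightarrow> int" and \<beta> :: real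
  assumes \<beta>: "pisot \<beta> \<or> salem \<beta>"
    and F: "nonneg_fps F1" "nonneg_fps F2" "0 \<in> fps_supp F1" "0 \<in> fps_supp F2"
    and conv: "fps_conv_radius (real_fps F1) \<ge> 1" "fps_conv_radius (real_fps F2) \<ge> 1"
    and near: "eventually (\<lambda>x. \<exists>s\<in>fps_supp F2. s \<le> x \<and> x \<le> 2 * s) sequentially"
    and grow: "\<And>K \<epsilon>. 0 < \<epsilon> \<Longrightarrow> \<epsilon> < 1 \<Longrightarrow> eventually (\<lambda>M. \<exists>N. M ^ K \<le> N \<and>
      psum F1 N \<le> 2 * int M \<and> psum F2 N ^ K \<le> int M \<and>
      (\<forall>x\<le>N. \<exists>s\<in>fps_supp F1. s \<le> x \<and>
        real (x - s) \<le> max (real N / real M ^ K) (real x / real M powr (1 - \<epsilon>)))) sequentially"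
    and A: "A g h > 0" "h \<le> J" "\<And>j. h < j \<Longrightarrow> j \<le> J \<Longrightarrow> A g j = 0"
  shows "(\<Sum>(i, j)\<in>{..g} \<times> {..J}. real_of_int (A i j) *
    (eval_fps (real_fps F1) (inverse \<beta>) ^ i * eval_fps (real_fps F2) (inverse \<beta>) ^ j)) \<noteq> 0"
proof
  define X where "X = inverse \<beta>"
  assume zero: "(\<Sum>(i, j)\<in>{..g} \<times> {..J}. real_of_int (A i j) *
    (eval_fps (real_fps F1) (inverse \<beta>) ^ i * eval_fps (real_fps F2) (inverse \<beta>) ^ j)) = 0"
  have \<beta>1: "\<beta> > 1" using \<beta> by (auto simp: pisot_def salem_def)
  have X: "0 < X" "X < 1" using \<beta>1 by (auto simp: X_def inverse_less_1_iff)
  define m where "m i j = F1 ^ i * F2 ^ j" for i j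
  have nonneg_m: "nonneg_fps (m i j)" for i j
    unfolding m_def by (intro nonneg_fps_mult nonneg_fps_power F)
  \<comment> \<open>The extra factor \<open>F2\<close> turns each exponent \<open>a\<close> of
    \<open>m g h\<close> into exponents \<open>a + s\<close> of the top monomial, with
    \<open>s\<close> in the support of \<open>F2\<close>.\<close>
  define c where "c = (\<Sum>p\<in>{..g} \<times> {..J}. fps_const (A (fst p) (snd p)) * m (fst p) (Suc (snd p)))"
  have m_conv: "fps_conv_radius (real_fps (m i j)) \<ge> 1" for i j
    unfolding m_def by (rule conv_radius_monomial[OF conv])
  have "\<bar>X\<bar> < 1" using X by simp
  note c_sum = eval_fps_sum_mult_const[of "{..g} \<times> {..J}" "\<lambda>p. m (fst p) (Suc (snd p))" X
    "\<lambda>p. A (fst p) (snd p)", OF _ m_conv this, folded c_def, simplified]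
  have c_conv: "fps_conv_radius (real_fps c) \<ge> 1" using c_sum by blast
  have c_eval: "eval_fps (real_fps c) X =
      (\<Sum>p\<in>{..g} \<times> {..J}. real_of_int (A (fst p) (snd p)) * eval_fps (real_fps (m (fst p) (Suc (snd p)))) X)"
    using c_sum by blast
  have m_eval: "eval_fps (real_fps (m i j)) X = eval_fps (real_fps F1) X ^ i * eval_fps (real_fps F2) X ^ j" for i j
  proof -
    have "ereal (norm X) < 1" using X by simp
    then have "ereal (norm X) < fps_conv_radius (real_fps F1)" "ereal (norm X) < fps_conv_radius (real_fps F2)"
      using conv less_le_trans by blast+
    then show ?thesis
      unfolding m_def real_fps_mult real_fps_power
      by (subst eval_fps_mult) (auto simp: eval_fps_power intro: less_le_trans[OF _ fps_conv_radius_power])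
  qed
  have "eval_fps (real_fps c) X = eval_fps (real_fps F2) X * (\<Sum>(i, j)\<in>{..g} \<times> {..J}. real_of_int (A i j) *
    (eval_fps (real_fps F1) X ^ i * eval_fps (real_fps F2) X ^ j))"
    unfolding c_eval sum_distrib_left m_eval by (intro sum.cong) auto
  then have c_zero: "eval_fps (real_fps c) (inverse \<beta>) = 0" using zero by (simp add: X_def)
  have c_nth: "fps_nth c n = (\<Sum>(i, j)\<in>{..g} \<times> {..J}. A i j * fps_nth (m i (Suc j)) n)" for n
    unfolding c_def by (simp add: fps_sum_nth case_prod_unfold)
  \<comment> \<open>\<open>AA\<close> absorbs the remaining monomials with the full power of
    \<open>F1\<close> (there \<open>Suc j \<le> h\<close>), and \<open>BB\<close> all those with a
    smaller power; for \<open>g = 0\<close> there are none of the latter.\<close>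
  define AA where "AA = fps_supp (m g h)"
  define BB where "BB = (if g = 0 then {} else fps_supp (m (g - 1) (Suc J)))"
  have c_free: "fps_nth c n = A g h * fps_nth (m g (Suc h)) n" if n: "n \<notin> AA" "n \<notin> BB" for n
  proof -
    have other: "A i j * fps_nth (m i (Suc j)) n = 0" if ij: "i \<le> g" "j \<le> J" "(i, j) \<noteq> (g, h)" for i j
    proof (cases "i = g")
      case True
      show ?thesis
      proof (cases "h < j")
        case True
        then show ?thesis using A(3)[OF True ij(2)] \<open>i = g\<close> by simp
      next
        case False
        then have "fps_supp (m i (Suc j)) \<subseteq> AA"
          unfolding AA_def m_def using True ij by (intro fps_supp_monomial_mono F) auto
        then show ?thesis using n by (auto simp: fps_supp_def)
      qed
    next
      case False
      then have "fps_supp (m i (Suc j)) \<subseteq> fps_supp (m (g - 1) (Suc J))"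
        unfolding m_def using ij by (intro fps_supp_monomial_mono F) auto
      then show ?thesis using n False ij by (auto simp: fps_supp_def BB_def split: if_splits)
    qed
    then have "fps_nth c n = (\<Sum>p\<in>{..g} \<times> {..J}. if p = (g, h) then A g h * fps_nth (m g (Suc h)) n else 0)"
      unfolding c_nth
    proof (intro sum.cong refl)
      fix p assume p: "p \<in> {..g} \<times> {..J}"
      show "(case p of (i, j) \<Rightarrow> A i j * fps_nth (m i (Suc j)) n)
        = (if p = (g, h) then A g h * fps_nth (m g (Suc h)) n else 0)"
        using other[of "fst p" "snd p"] p
        by (cases p) auto
    qed
    then show ?thesis using A(2) by simp
  qed
  obtain C D :: nat where CD: "\<And>N. card {u. 2 * u \<le> N \<and> (\<Sum>n\<le>u. real_of_int (fps_nth c n) * X ^ n) \<noteq> 0}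
      \<le> C * nat (1 + (\<Sum>n\<le>N. \<bar>fps_nth c n\<bar>)) ^ D"
    using card_nonzero_partial_sums[OF \<beta> c_conv c_zero] unfolding X_def by blast
  define a0 where "a0 = nat (\<Sum>(i, j)\<in>{..g} \<times> {..J}. \<bar>A i j\<bar>)"
  \<comment> \<open>The count of nonzero partial sums is at most
    \<open>C * (M ^ (g + 2)) ^ D\<close>, and \<open>C \<le> M\<close>, which gives
    \<open>M ^ Q\<close>.\<close>
  define Q where "Q = (g + 2) * D + 1"
  \<comment> \<open>\<open>Q + g + 2\<close> makes \<open>N\<close> large against the points of
    \<open>AA\<close> times the gap length; \<open>4 * (J + 1)\<close> makes
    \<open>psum F2 N ^ (J + 1)\<close> at most the fourth root of \<open>M\<close>.\<close>
  define K where "K = Q + g + 2 + 4 * (J + 1)"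
  \<comment> \<open>The \<open>g\<close> approximation steps in \<open>F1 ^ g\<close> together lose
    at most a factor \<open>M powr (1 / 4)\<close>.\<close>
  define \<epsilon> :: real where "\<epsilon> = 1 / (4 * (real g + 1))"
  have \<epsilon>: "0 < \<epsilon>" "\<epsilon> < 1" "real g * \<epsilon> \<le> 1 / 4"
    by (auto simp: \<epsilon>_def field_simps)
  obtain x0 where x0: "\<And>x. x \<ge> x0 \<Longrightarrow> \<exists>s\<in>fps_supp F2. s \<le> x \<and> x \<le> 2 * s"
    using near unfolding eventually_sequentially by blast
  have "eventually (\<lambda>M. real M powr (1/2) \<ge> 2 ^ (g + 2)) sequentially" by real_asymp
  then have "eventually (\<lambda>M. M \<ge> 2 ^ (g + 5) \<and> M \<ge> a0 * 2 ^ g + 1 \<and> M \<ge> C \<and> M \<ge> x0 \<and> real M powr (1/2) \<ge> 2 ^ (g + 2) \<and>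
      (\<exists>N. M ^ K \<le> N \<and> psum F1 N \<le> 2 * int M \<and> psum F2 N ^ K \<le> int M \<and>
      (\<forall>x\<le>N. \<exists>s\<in>fps_supp F1. s \<le> x \<and>
        real (x - s) \<le> max (real N / real M ^ K) (real x / real M powr (1 - \<epsilon>))))) sequentially"
    using grow[OF \<epsilon>(1,2), of K] eventually_ge_at_top[of "2 ^ (g + 5)"] eventually_ge_at_top[of "a0 * 2 ^ g + 1"]
      eventually_ge_at_top[of C] eventually_ge_at_top[of x0] by eventually_elim blast
  then obtain M N where M: "M \<ge> 2 ^ (g + 5)" "M \<ge> a0 * 2 ^ g + 1" "M \<ge> C" "M \<ge> x0" "real M powr (1/2) \<ge> 2 ^ (g + 2)"
    and N: "M ^ K \<le> N" "psum F1 N \<le> 2 * int M" "psum F2 N ^ K \<le> int M"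
    and dense: "\<And>x. x \<le> N \<Longrightarrow> \<exists>s\<in>fps_supp F1. s \<le> x \<and>
        real (x - s) \<le> max (real N / real M ^ K) (real x / real M powr (1 - \<epsilon>))"
    unfolding eventually_sequentially by blast
  have M1: "M \<ge> 1" using M(2) by simp
  \<comment> \<open>One factor \<open>r\<close> pays for the loss of density and one for the
    exponents of \<open>F2\<close>; their product is only the square root of
    \<open>M\<close>.\<close>
  define r where "r = real M powr (1 / 4)"
  have r1: "r \<ge> 1" unfolding r_def using M1 by (intro ge_one_powr_ge_zero) auto
  have r2: "r ^ 2 = real M powr (1 / 2)" unfolding r_def using M1 by (simp add: powr_power)
  have r4: "r ^ 4 = real M" unfolding r_def using M1 by (simp add: powr_power)
  have psum1: "psum F1 N \<ge> 1" and psum2: "psum F2 N \<ge> 1" by (auto intro: psum_ge_1 F)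
  have "psum F2 N ^ (4 * (J + 1)) \<le> psum F2 N ^ K"
    using psum2 by (intro power_increasing) (auto simp: K_def)
  then have p2_4: "psum F2 N ^ (4 * (J + 1)) \<le> int M" using N(3) by linarith
  have p2_r: "real_of_int (psum F2 N) ^ (J + 1) \<le> r"
  proof (rule power_le_imp_le_base[of _ 3])
    show "(real_of_int (psum F2 N) ^ (J + 1)) ^ Suc 3 \<le> r ^ Suc 3"
    proof -
      have "(real_of_int (psum F2 N) ^ (J + 1)) ^ Suc 3 = real_of_int (psum F2 N ^ (4 * (J + 1)))"
        by (simp only: of_int_power power_mult [symmetric] mult.commute) simp
      also have "\<dots> \<le> real M" using p2_4 by (metis of_int_le_iff of_int_of_nat_eq)
      also have "\<dots> = r ^ Suc 3" using r4 by (simp add: eval_nat_numeral)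
      finally show ?thesis .
    qed
  qed (use r1 in auto)
  have "psum F2 N ^ (J + 1) \<le> psum F2 N ^ (4 * (J + 1))"
    using psum2 by (intro power_increasing) auto
  then have p2_M: "psum F2 N ^ (J + 1) \<le> int M" using p2_4 by linarith
  have psum_m: "psum (m i j) N \<le> int (2 ^ g * M ^ (g + 1))" if "i \<le> g" "j \<le> J + 1" for i j
  proof -
    have "psum (m i j) N \<le> psum F1 N ^ i * psum F2 N ^ j" unfolding m_def by (intro psum_monomial_le F)
    also have "\<dots> \<le> psum F1 N ^ g * psum F2 N ^ (J + 1)"
      using that psum1 psum2 by (intro mult_mono power_increasing) auto
    also have "\<dots> \<le> (2 * int M) ^ g * int M"
      using p2_M psum1 psum2 N(2) by (intro mult_mono power_mono) auto
    finally show ?thesis by (simp add: power_mult_distrib mult_ac)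
  qed
  have sum_c: "(\<Sum>n\<le>N. \<bar>fps_nth c n\<bar>) \<le> int a0 * int (2 ^ g * M ^ (g + 1))"
  proof -
    have "(\<Sum>n\<le>N. \<bar>fps_nth c n\<bar>) \<le> (\<Sum>n\<le>N. \<Sum>(i, j)\<in>{..g} \<times> {..J}. \<bar>A i j\<bar> * fps_nth (m i (Suc j)) n)"
      unfolding c_nth using nonneg_m
      by (intro sum_mono order_trans[OF sum_abs] sum_mono) (auto simp: abs_mult nonneg_fps_def)
    also have "\<dots> = (\<Sum>(i, j)\<in>{..g} \<times> {..J}. \<bar>A i j\<bar> * psum (m i (Suc j)) N)"
      unfolding psum_def sum_distrib_left case_prod_unfold by (rule sum.swap)
    also have "\<dots> \<le> (\<Sum>(i, j)\<in>{..g} \<times> {..J}. \<bar>A i j\<bar> * int (2 ^ g * M ^ (g + 1)))"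
    proof (rule sum_mono)
      fix p assume "p \<in> {..g} \<times> {..J}"
      then have "psum (m (fst p) (Suc (snd p))) N \<le> int (2 ^ g * M ^ (g + 1))" by (intro psum_m) auto
      then show "(case p of (i, j) \<Rightarrow> \<bar>A i j\<bar> * psum (m i (Suc j)) N) \<le> (case p of (i, j) \<Rightarrow> \<bar>A i j\<bar> * int (2 ^ g * M ^ (g + 1)))"
        unfolding case_prod_unfold by (intro mult_left_mono) auto
    qed
    also have "\<dots> = (\<Sum>(i, j)\<in>{..g} \<times> {..J}. \<bar>A i j\<bar>) * int (2 ^ g * M ^ (g + 1))"
      unfolding sum_distrib_right case_prod_unfold ..
    also have "(\<Sum>(i, j)\<in>{..g} \<times> {..J}. \<bar>A i j\<bar>) = int a0"
      unfolding a0_def by (simp add: sum_nonneg case_prod_unfold)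
    finally show ?thesis .
  qed
  have "nat (1 + (\<Sum>n\<le>N. \<bar>fps_nth c n\<bar>)) \<le> M ^ (g + 2)"
  proof -
    have "1 + a0 * (2 ^ g * M ^ (g + 1)) \<le> (a0 * 2 ^ g + 1) * M ^ (g + 1)"
      using M1 by (simp add: algebra_simps)
    also have "\<dots> \<le> M * M ^ (g + 1)" using M(2) by (intro mult_right_mono) auto
    finally have "1 + a0 * (2 ^ g * M ^ (g + 1)) \<le> M ^ (g + 2)" by simp
    then have "int (1 + a0 * (2 ^ g * M ^ (g + 1))) \<le> int (M ^ (g + 2))" by (simp only: of_nat_le_iff)
    moreover have "int (1 + a0 * (2 ^ g * M ^ (g + 1))) = 1 + int a0 * int (2 ^ g * M ^ (g + 1))"
      by (simp only: of_nat_add of_nat_mult of_nat_1)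
    ultimately have "1 + (\<Sum>n\<le>N. \<bar>fps_nth c n\<bar>) \<le> int (M ^ (g + 2))" using sum_c by linarith
    then show ?thesis by (simp only: nat_le_iff)
  qed
  then have "C * nat (1 + (\<Sum>n\<le>N. \<bar>fps_nth c n\<bar>)) ^ D \<le> M * (M ^ (g + 2)) ^ D"
    using M(3) by (intro mult_mono power_mono) auto
  also have "\<dots> = M ^ Q" unfolding Q_def power_add power_mult by (simp only: power_one_right mult.commute)
  finally have "card {u. 2 * u \<le> N \<and> (\<Sum>n\<le>u. real_of_int (fps_nth c n) * X ^ n) \<noteq> 0} \<le> M ^ Q"
    using CD[of N] by linarith
  moreover have MQ: "M ^ Q \<ge> 1" using M1 by simp
  ultimately have few: "card {u. 2 * u \<le> N \<and> (\<Sum>n\<le>u. real_of_int (fps_nth c n) * X ^ n) \<noteq> 0} < 2 * M ^ Q" by linarith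
  \<comment> \<open>Upper bound for the distance from any \<open>x \<le> N\<close> down to
    \<open>AA\<close>.\<close>
  define G where "G = nat \<lfloor>real N * r / real M ^ g\<rfloor>"
  have Mg: "real M ^ g > 0" using M1 by simp
  have N0: "real N > 0" using N(1) M1 by (metis of_nat_0_less_iff less_le_trans zero_less_power zero_less_one)
  have MgN: "real M ^ g \<le> real N"
  proof -
    have "M ^ g \<le> M ^ K" using M1 by (intro power_increasing) (auto simp: K_def)
    then have "M ^ g \<le> N" using N(1) by linarith
    then show ?thesis by (metis of_nat_le_iff of_nat_power)
  qed
  have near_AA: "\<exists>a\<in>AA. a \<le> x \<and> x - a \<le> G" if "x \<le> N" for x
  proof -
    note x_le = that
    define q where "q = real M powr (1 - \<epsilon>)"
    have q1: "q \<ge> 1" unfolding q_def using M1 \<epsilon> by (intro ge_one_powr_ge_zero) auto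
    obtain a where a: "a \<in> fps_supp (F1 ^ g)" "a \<le> x" "real (x - a) \<le> max (real N / real M ^ K) (real x / q ^ g)"
      using dense_power[OF F(1) q1 _ dense[folded q_def] x_le, of g] by fastforce
    have "real M ^ g / r \<le> q ^ g"
    proof -
      have "real M ^ g / r = real M powr (real g - 1 / 4)"
        using M1 by (simp add: r_def powr_diff powr_realpow)
      also have "\<dots> \<le> real M powr (real g * (1 - \<epsilon>))"
        using \<epsilon> M1 by (intro powr_mono) (auto simp: algebra_simps)
      also have "\<dots> = q ^ g" using M1 by (simp add: q_def powr_power mult.commute)
      finally show ?thesis .
    qed
    then have "real x / q ^ g \<le> real N / (real M ^ g / r)"
      using that r1 Mg by (intro frac_le) auto
    moreover have "real N / real M ^ K \<le> real N / (real M ^ g / r)"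
    proof -
      have "real M ^ g / r \<le> real M ^ g" using r1 Mg by (simp add: divide_le_eq)
      also have "\<dots> \<le> real M ^ K" using M1 by (intro power_increasing) (auto simp: K_def)
      finally show ?thesis using r1 Mg by (intro frac_le) auto
    qed
    ultimately have "real (x - a) \<le> real N * r / real M ^ g" using a(3) by simp
    then have "x - a \<le> G" unfolding G_def by (rule le_nat_floor)
    moreover have "a \<in> AA"
      using a(1) fps_supp_monomial_mono[OF F, of g g 0 h] by (auto simp: AA_def m_def)
    ultimately show ?thesis using a(2) by blast
  qed
  \<comment> \<open>The gap consists of three stretches of length \<open>2 * M ^ Q\<close>: a zero
    of the partial sums in the first, the position \<open>a + s\<close> in the second, and room for
    another zero in the third.\<close>
  have card_AA: "4 * (card (AA \<inter> {..N}) * (6 * M ^ Q)) < N"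
  proof -
    have "int (card (AA \<inter> {..N})) \<le> int (2 ^ g * M ^ (g + 1))"
      unfolding AA_def using card_fps_supp_le[OF nonneg_m, of g h N] psum_m[of g h] A(2) by linarith
    then have "card (AA \<inter> {..N}) \<le> 2 ^ g * M ^ (g + 1)" by (simp only: of_nat_le_iff)
    then have "card (AA \<inter> {..N}) * (6 * M ^ Q) \<le> 2 ^ g * M ^ (g + 1) * (6 * M ^ Q)"
      by (rule mult_right_mono) simp
    also have "\<dots> = 6 * 2 ^ g * M ^ (Q + g + 1)" by (simp add: power_add)
    finally have 1: "card (AA \<inter> {..N}) * (6 * M ^ Q) \<le> 6 * 2 ^ g * M ^ (Q + g + 1)" .
    have "32 * 2 ^ g * M ^ (Q + g + 1) \<le> M * M ^ (Q + g + 1)"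
      using M(1) by (intro mult_right_mono) (auto simp: power_add)
    also have "\<dots> \<le> M ^ K" unfolding power_Suc [symmetric] using M1 by (intro power_increasing) (auto simp: K_def)
    finally have "32 * 2 ^ g * M ^ (Q + g + 1) \<le> N" using N(1) by linarith
    moreover have "2 ^ g * M ^ (Q + g + 1) > 0" using M1 by simp
    ultimately show ?thesis using 1 by linarith
  qed
  \<comment> \<open>About \<open>M ^ (g - 1) * r\<close> points times a distance of about
    \<open>N * r / M ^ g\<close> gives order \<open>N / r ^ 2\<close>; the condition on
    \<open>M powr (1/2)\<close> brings this below \<open>N / 4\<close>.\<close>
  have card_BB: "4 * (card (BB \<inter> {..N}) * (G + 1)) \<le> N"
  proof (cases "g = 0")
    case True
    then show ?thesis by (simp add: BB_def)
  next
    case False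
    have "int (card (BB \<inter> {..N})) \<le> psum (m (g - 1) (Suc J)) N"
      using False card_fps_supp_le[OF nonneg_m] by (simp add: BB_def)
    also have "\<dots> \<le> psum F1 N ^ (g - 1) * psum F2 N ^ Suc J" unfolding m_def by (intro psum_monomial_le F)
    also have "\<dots> \<le> (2 * int M) ^ (g - 1) * psum F2 N ^ Suc J"
      using psum1 psum2 N(2) by (intro mult_right_mono power_mono) auto
    finally have "real_of_int (int (card (BB \<inter> {..N}))) \<le> real_of_int ((2 * int M) ^ (g - 1) * psum F2 N ^ Suc J)"
      by (simp only: of_int_le_iff)
    also have "\<dots> = (2 * real M) ^ (g - 1) * real_of_int (psum F2 N) ^ (J + 1)" by simp
    also have "\<dots> \<le> (2 * real M) ^ (g - 1) * r" using p2_r by (intro mult_left_mono) auto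
    finally have 1: "real (card (BB \<inter> {..N})) \<le> (2 * real M) ^ (g - 1) * r" by simp
    have ratio: "real N * r / real M ^ g \<ge> 1"
    proof -
      have "real M ^ g * 1 \<le> real N * r" using MgN r1 by (intro mult_mono) auto
      then show ?thesis using Mg by simp
    qed
    then have "real G \<le> real N * r / real M ^ g"
      unfolding G_def by (intro of_nat_floor) linarith
    then have 2: "real (G + 1) \<le> 2 * (real N * r / real M ^ g)"
      unfolding of_nat_add of_nat_1 mult_2 using ratio by (rule add_mono)
    have "real (card (BB \<inter> {..N})) * real (G + 1) \<le> ((2 * real M) ^ (g - 1) * r) * (2 * (real N * r / real M ^ g))"
      using 1 2 r1 by (intro mult_mono) auto
    also have "\<dots> = 2 ^ g * (real M ^ (g - 1) / real M ^ g) * real N * r ^ 2"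
      using power_eq_if[of "2 :: real" g] False by (simp add: power_mult_distrib power2_eq_square)
    also have "real M ^ (g - 1) / real M ^ g = 1 / r ^ 4"
      using power_eq_if[of "real M" g] False M1 by (simp add: r4)
    also have "2 ^ g * (1 / r ^ 4) * real N * r ^ 2 = 2 ^ g * real N / r ^ 2"
      using r1 by (simp add: field_simps eval_nat_numeral)
    also have "\<dots> \<le> 2 ^ g * real N / 2 ^ (g + 2)"
    proof (rule divide_left_mono)
      show "2 ^ (g + 2) \<le> r ^ 2" using M(5) by (simp only: r2)
      show "0 < r ^ 2 * 2 ^ (g + 2)" using r1 by (intro mult_pos_pos zero_less_power) auto
    qed auto
    also have "\<dots> = real N / 4" by (simp add: power_add)
    finally have "real (4 * (card (BB \<inter> {..N}) * (G + 1))) \<le> real N" by (simp add: algebra_simps)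
    then show ?thesis by (simp only: of_nat_le_iff)
  qed
  have "2 * (u + v) < N" if "4 * v < N" "4 * u \<le> N" for u v :: nat
    using that by presburger
  from this[OF card_AA card_BB] obtain a x where x: "2 * x \<le> N" "a \<in> AA" "a + 6 * M ^ Q \<le> x"
    and free: "\<And>n. a < n \<Longrightarrow> n \<le> x \<Longrightarrow> n \<notin> AA \<and> n \<notin> BB"
    using gap_exists[OF near_AA] by blast
  have "4 * M ^ Q \<ge> M"
    using power_increasing[of 1 Q M] M1 by (simp add: Q_def)
  \<comment> \<open>An exponent of \<open>F2\<close> in the middle stretch, between
    \<open>2 * M ^ Q\<close> and \<open>4 * M ^ Q\<close>.\<close>
  then obtain s where s: "s \<in> fps_supp F2" "s \<le> 4 * M ^ Q" "4 * M ^ Q \<le> 2 * s"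
    using x0[of "4 * M ^ Q"] M(4) by auto
  have nonneg_c: "fps_nth c n \<ge> 0" if "a < n" "n \<le> x" for n
    using free[OF that] A(1) nonneg_m[of g "Suc h"] by (simp add: c_free nonneg_fps_def)
  have "fps_nth c (a + s) = 0"
    by (rule zeros_not_separated[OF X(1) few x(1) _ nonneg_c]) (use x s in auto)
  moreover have "a + s \<notin> AA \<and> a + s \<notin> BB"
    using free[of "a + s"] s x MQ by auto
  moreover have "a + s \<in> fps_supp (m g (Suc h))"
    using fps_supp_mult[OF nonneg_m F(2) _ s(1), of a g h] x(2) by (simp add: AA_def m_def mult_ac)
  ultimately show False using A(1) by (simp add: c_free fps_supp_def)
qed

section \<open>Algebraic independence\<close>

text \<open>Exponents may coincide, so a coefficient counts indices; the 1 at \<open>n = 0\<close>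
  is the constant term of \<open>xi\<close>. As \<open>card\<close> is 0 on infinite sets, later
  lemmas assume finite fibres.\<close>

definition lacunary_fps :: "(nat \<Rightarrow> nat) \<Rightarrow> int fps" where
  "lacunary_fps e = Abs_fps (\<lambda>n. (if n = 0 then 1 else 0) + int (card {m. e m = n}))"

lemma lacunary_fps_nth: "fps_nth (lacunary_fps e) n = (if n = 0 then 1 else 0) + int (card {m. e m = n})"
  by (simp add: lacunary_fps_def)

lemma nonneg_lacunary_fps: "nonneg_fps (lacunary_fps e)"
  by (simp add: nonneg_fps_def lacunary_fps_nth)

lemma zero_in_supp_lacunary_fps: "0 \<in> fps_supp (lacunary_fps e)"
proof -
  have "fps_nth (lacunary_fps e) 0 > 0" by (simp add: lacunary_fps_nth)
  then show ?thesis by (simp add: fps_supp_def)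
qed

lemma in_supp_lacunary_fps:
  assumes "finite {m. e m = e k}"
  shows "e k \<in> fps_supp (lacunary_fps e)"
proof -
  have "card {m. e m = e k} > 0" using assms by (auto simp: card_gt_0_iff)
  then have "fps_nth (lacunary_fps e) (e k) > 0" by (simp add: lacunary_fps_nth)
  then show ?thesis by (simp add: fps_supp_def)
qed

lemma psum_lacunary_fps:
  assumes "finite {m. e m \<le> N}"
  shows "psum (lacunary_fps e) N = 1 + int (card {m. e m \<le> N})"
proof -
  have fin: "finite {m. e m = n}" if "n \<le> N" for n
    by (rule finite_subset[OF _ assms]) (use that in auto)
  have "{m. e m \<le> N} = (\<Union>n\<in>{..N}. {m. e m = n})" by auto
  also have "card \<dots> = (\<Sum>n\<le>N. card {m. e m = n})"
    using fin by (intro card_UN_disjoint) auto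
  finally show ?thesis by (simp add: psum_def lacunary_fps_nth sum.distrib)
qed

text \<open>Absolute convergence allows regrouping the terms by the value of the exponent: the graph
  of \<open>e\<close> is split into its fibres.\<close>

lemma lacunary_fps_sums:
  fixes Y :: real
  assumes fin: "\<And>n. finite {m. e m = n}" and ge: "eventually (\<lambda>m. m \<le> e m) sequentially"
    and Y: "0 < Y" "Y < 1"
  shows "(\<lambda>n. real_of_int (fps_nth (lacunary_fps e) n) * Y ^ n) sums (1 + (\<Sum>m. Y ^ e m))"
proof -
  have summ: "summable (\<lambda>m. norm (Y ^ e m))"
  proof (rule summable_comparison_test_ev)
    show "eventually (\<lambda>m. norm (norm (Y ^ e m)) \<le> Y ^ m) sequentially"
      using ge by eventually_elim (use Y in \<open>auto intro: power_decreasing\<close>)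
  qed (use Y in auto)
  then have "((\<lambda>m. Y ^ e m) has_sum (\<Sum>m. Y ^ e m)) UNIV"
    by (intro norm_summable_imp_has_sum summable_sums summable_norm_cancel[OF summ])
  then have "((\<lambda>(n, m). Y ^ n) has_sum (\<Sum>m. Y ^ e m)) (range (\<lambda>m. (e m, m)))"
    by (subst has_sum_reindex) (auto simp: inj_on_def o_def)
  moreover have "range (\<lambda>m. (e m, m)) = Sigma UNIV (\<lambda>n. {m. e m = n})" by auto
  ultimately have "((\<lambda>(n, m). Y ^ n) has_sum (\<Sum>m. Y ^ e m)) (Sigma UNIV (\<lambda>n. {m. e m = n}))" by simp
  then have "((\<lambda>n. real (card {m. e m = n}) * Y ^ n) has_sum (\<Sum>m. Y ^ e m)) UNIV"
  proof (rule has_sum_SigmaD)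
    fix n
    show "((\<lambda>m. case (n, m) of (n, m) \<Rightarrow> Y ^ n) has_sum (real (card {m. e m = n}) * Y ^ n)) {m. e m = n}"
      using has_sum_finite[OF fin, of "\<lambda>m. Y ^ n" n] by simp
  qed
  then have "(\<lambda>n. real (card {m. e m = n}) * Y ^ n) sums (\<Sum>m. Y ^ e m)" by (rule has_sum_imp_sums)
  then have "(\<lambda>n. (if n = 0 then 1 else 0) + real (card {m. e m = n}) * Y ^ n) sums (1 + (\<Sum>m. Y ^ e m))"
    by (intro sums_add sums_single[of 0 "\<lambda>_. 1"])
  moreover have "(if n = 0 then 1 else 0) + real (card {m. e m = n}) * Y ^ n
      = real_of_int (fps_nth (lacunary_fps e) n) * Y ^ n" for n
    by (simp add: lacunary_fps_nth algebra_simps)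
  ultimately show ?thesis by (simp only:)
qed

lemma conv_radius_lacunary_fps:
  assumes "\<And>n. finite {m. e m = n}" "eventually (\<lambda>m. m \<le> e m) sequentially"
  shows "fps_conv_radius (real_fps (lacunary_fps e)) \<ge> 1"
  unfolding fps_conv_radius_def
proof (rule conv_radius_geI_ex')
  fix r :: real assume "0 < r" "ereal r < 1"
  then show "summable (\<lambda>n. fps_nth (real_fps (lacunary_fps e)) n * of_real r ^ n)"
    using lacunary_fps_sums[OF assms, of r] by (simp add: sums_iff)
qed

lemma eval_lacunary_fps_expo:
  assumes "(y, z) \<in> Theta" "0 < X" "X < 1"
  shows "eval_fps (real_fps (lacunary_fps (expo y z))) X = xi y z X"
proof -
  have "finite {m. expo y z m = n}" for n
    by (rule finite_subset[OF _ finite_expo_le[OF assms(1), of n]]) auto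
  from lacunary_fps_sums[OF this eventually_expo_ge[OF assms(1)] assms(2,3)]
  show ?thesis unfolding eval_fps_def real_fps_nth xi_def expo_def [symmetric] by (simp add: sums_iff)
qed

lemma eventually_sparse_power_le:
  assumes "(y1, z1) \<in> Theta" "(y2, z2) \<in> Theta" "y1 < y2 \<or> y1 = y2 \<and> z1 < z2"
  shows "eventually (\<lambda>M. psum (lacunary_fps (expo y2 z2)) (nat \<lfloor>phi y1 z1 (real M)\<rfloor>) ^ K \<le> int M) sequentially"
proof -
  \<comment> \<open>The square \<open>r ^ 2\<close> absorbs the additive constant
    \<open>C + 2\<close> once \<open>r \<ge> C + 2\<close>; smaller \<open>r\<close> are handled by
    taking \<open>M\<close> large.\<close>
  define K' where "K' = 2 * K + 1"
  obtain C where C: "eventually (\<lambda>M. \<forall>m. expo y2 z2 m \<le> nat \<lfloor>phi y1 z1 (real M)\<rfloor> \<longrightarrow> m < C \<or> m ^ K' \<le> M) sequentially"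
    using eventually_expo_le_imp_sparse[OF assms(1,3), of K'] by (auto simp: K'_def)
  show ?thesis using C eventually_ge_at_top[of "(2 * (C + 2)) ^ K"]
  proof eventually_elim
    case (elim M)
    define N where "N = nat \<lfloor>phi y1 z1 (real M)\<rfloor>"
    define r where "r = Max {m. m ^ K' \<le> M}"
    have "0 < K'" by (simp add: K'_def)
    then have "m \<le> M" if "m ^ K' \<le> M" for m
      using that self_le_power[of m K'] by (cases "m = 0") auto
    then have "{m. m ^ K' \<le> M} \<subseteq> {..M}" by blast
    then have fin: "finite {m. m ^ K' \<le> M}" using finite_subset by blast
    have "0 \<in> {m. m ^ K' \<le> M}" by (simp add: K'_def)
    then have "r \<in> {m. m ^ K' \<le> M}" unfolding r_def using fin by (intro Max_in) auto
    then have r: "r ^ K' \<le> M" by simp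
    have "m \<le> r" if "m ^ K' \<le> M" for m
      unfolding r_def using fin that by (intro Max_ge) auto
    then have "{m. expo y2 z2 m \<le> N} \<subseteq> {..<C} \<union> {..r}"
      using elim(1) unfolding N_def by auto
    then have "card {m. expo y2 z2 m \<le> N} \<le> card ({..<C} \<union> {..r})"
      by (intro card_mono) auto
    also have "\<dots> \<le> C + (r + 1)" using card_Un_le[of "{..<C}" "{..r}"] by simp
    finally have "psum (lacunary_fps (expo y2 z2)) N \<le> int (C + 2 + r)"
      using psum_lacunary_fps[OF finite_expo_le[OF assms(2)], of N] by simp
    then have "psum (lacunary_fps (expo y2 z2)) N ^ K \<le> int (C + 2 + r) ^ K"
      by (intro power_mono psum_nonneg nonneg_lacunary_fps)
    also have "\<dots> = int ((C + 2 + r) ^ K)" by simp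
    also have "(C + 2 + r) ^ K \<le> M"
    proof (cases "r \<ge> C + 2")
      case True
      then have "C + 2 + r \<le> 2 * r" by simp
      also have "\<dots> \<le> r * r" using True by (intro mult_right_mono) auto
      finally have "(C + 2 + r) ^ K \<le> (r ^ 2) ^ K" by (intro power_mono) (auto simp: power2_eq_square)
      also have "\<dots> \<le> r ^ K'" unfolding power_mult [symmetric] using True by (intro power_increasing) (auto simp: K'_def)
      finally show ?thesis using r by simp
    next
      case False
      then have "(C + 2 + r) ^ K \<le> (2 * (C + 2)) ^ K" by (intro power_mono) auto
      then show ?thesis using elim(2) by simp
    qed
    finally show ?case unfolding N_def by simp
  qed
qed

lemma integer_polynomial_xi_nonzero:
  fixes A :: "nat \<Rightarrow> nat \<Rightarrow> int"
  assumes \<beta>: "pisot \<beta> \<or> salem \<beta>"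
    and Th: "(y1, z1) \<in> Theta" "(y2, z2) \<in> Theta" and less: "y1 < y2 \<or> y1 = y2 \<and> z1 < z2"
    and A: "A i0 j0 \<noteq> 0" "i0 \<le> I" "j0 \<le> J"
  shows "(\<Sum>i\<le>I. \<Sum>j\<le>J. real_of_int (A i j) * xi y1 z1 (inverse \<beta>) ^ i * xi y2 z2 (inverse \<beta>) ^ j) \<noteq> 0"
proof -
  define X where "X = inverse \<beta>"
  have "\<beta> > 1" using \<beta> by (auto simp: pisot_def salem_def)
  then have X: "0 < X" "X < 1" by (auto simp: X_def inverse_less_1_iff)
  define F1 F2 where "F1 = lacunary_fps (expo y1 z1)" and "F2 = lacunary_fps (expo y2 z2)"
  have fin1: "finite {m. expo y1 z1 m = n}" and fin2: "finite {m. expo y2 z2 m = n}" for n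
    using finite_subset[OF _ finite_expo_le[OF Th(1), of n], of "{m. expo y1 z1 m = n}"]
      finite_subset[OF _ finite_expo_le[OF Th(2), of n], of "{m. expo y2 z2 m = n}"] by auto
  have F: "nonneg_fps F1" "nonneg_fps F2" "0 \<in> fps_supp F1" "0 \<in> fps_supp F2"
    unfolding F1_def F2_def by (intro nonneg_lacunary_fps zero_in_supp_lacunary_fps)+
  have conv: "fps_conv_radius (real_fps F1) \<ge> 1" "fps_conv_radius (real_fps F2) \<ge> 1"
    unfolding F1_def F2_def by (intro conv_radius_lacunary_fps fin1 fin2 eventually_expo_ge Th)+
  have near: "eventually (\<lambda>x. \<exists>s\<in>fps_supp F2. s \<le> x \<and> x \<le> 2 * s) sequentially"
    using eventually_expo_near[OF Th(2)]
    by eventually_elim (use in_supp_lacunary_fps[OF fin2] in \<open>auto simp: F2_def\<close>)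
  have grow: "eventually (\<lambda>M. \<exists>N. M ^ K \<le> N \<and> psum F1 N \<le> 2 * int M \<and> psum F2 N ^ K \<le> int M \<and>
      (\<forall>x\<le>N. \<exists>s\<in>fps_supp F1. s \<le> x \<and>
        real (x - s) \<le> max (real N / real M ^ K) (real x / real M powr (1 - \<epsilon>)))) sequentially"
    if \<epsilon>: "0 < \<epsilon>" "\<epsilon> < 1" for K \<epsilon>
    using eventually_expo_dense[OF Th(1) \<epsilon>, of K] eventually_power_le_floor_phi[OF Th(1), of K]
      eventually_sparse_power_le[OF Th less, of K] eventually_expo_le_imp[OF Th(1)] eventually_ge_at_top[of 1]
  proof eventually_elim
    case (elim M)
    define N where "N = nat \<lfloor>phi y1 z1 (real M)\<rfloor>"
    have "{m. expo y1 z1 m \<le> N} \<subseteq> {..<M}" using elim(4) by (auto simp: N_def)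
    then have "card {m. expo y1 z1 m \<le> N} \<le> M" using card_mono[of "{..<M}"] by fastforce
    then have "psum F1 N \<le> 2 * int M"
      using elim(5) unfolding F1_def psum_lacunary_fps[OF finite_expo_le[OF Th(1)]] by linarith
    moreover have "insert 0 (range (expo y1 z1)) \<subseteq> fps_supp F1"
      using F(3) in_supp_lacunary_fps[OF fin1] by (auto simp: F1_def)
    ultimately show ?case
      using elim(1-3) unfolding F2_def [symmetric] N_def [symmetric] by (intro exI[of _ N]) blast
  qed
  \<comment> \<open>Selects the lexicographically largest pair \<open>(g, h)\<close> with a nonzero
    coefficient, the power of the slower series first.\<close>
  define R where "R = {i. i \<le> I \<and> (\<exists>j\<le>J. A i j \<noteq> 0)}"
  define g where "g = Max R"
  have finR: "finite R" unfolding R_def by simp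
  have "g \<in> R" unfolding g_def using finR A by (intro Max_in) (auto simp: R_def)
  have gmax: "A i j = 0" if "g < i" "i \<le> I" "j \<le> J" for i j
  proof (rule ccontr)
    assume "A i j \<noteq> 0"
    then have "i \<in> R" using that by (auto simp: R_def)
    then show False using Max_ge[OF finR] that(1) by (fastforce simp: g_def)
  qed
  define S where "S = {j. j \<le> J \<and> A g j \<noteq> 0}"
  define h where "h = Max S"
  have finS: "finite S" unfolding S_def by simp
  have "h \<in> S" unfolding h_def using finS \<open>g \<in> R\<close> by (intro Max_in) (auto simp: S_def R_def)
  have hmax: "A g j = 0" if "h < j" "j \<le> J" for j
  proof (rule ccontr)
    assume "A g j \<noteq> 0"
    then have "j \<in> S" using that by (auto simp: S_def)
    then show False using Max_ge[OF finS] that(1) by (fastforce simp: h_def)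
  qed
  \<comment> \<open>A global sign change makes the top coefficient positive.\<close>
  define \<sigma> where "\<sigma> = sgn (A g h)"
  have \<sigma>: "\<sigma> \<noteq> 0" "\<sigma> * A g h > 0" using \<open>h \<in> S\<close> by (auto simp: \<sigma>_def S_def sgn_if)
  have "(\<Sum>(i, j)\<in>{..g} \<times> {..J}. real_of_int (\<sigma> * A i j) *
    (eval_fps (real_fps F1) (inverse \<beta>) ^ i * eval_fps (real_fps F2) (inverse \<beta>) ^ j)) \<noteq> 0"
    by (rule top_monomial_nonzero[OF \<beta> F conv near grow, of _ _ h]) (use \<sigma> hmax \<open>h \<in> S\<close> in \<open>auto simp: S_def\<close>)
  also have "(\<Sum>(i, j)\<in>{..g} \<times> {..J}. real_of_int (\<sigma> * A i j) *
      (eval_fps (real_fps F1) (inverse \<beta>) ^ i * eval_fps (real_fps F2) (inverse \<beta>) ^ j))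
    = real_of_int \<sigma> * (\<Sum>i\<le>g. \<Sum>j\<le>J. real_of_int (A i j) * xi y1 z1 (inverse \<beta>) ^ i * xi y2 z2 (inverse \<beta>) ^ j)"
    using eval_lacunary_fps_expo[OF Th(1) X] eval_lacunary_fps_expo[OF Th(2) X]
    unfolding sum.cartesian_product sum_distrib_left F1_def F2_def X_def
    by (intro sum.cong) auto
  also have "(\<Sum>i\<le>g. \<Sum>j\<le>J. real_of_int (A i j) * xi y1 z1 (inverse \<beta>) ^ i * xi y2 z2 (inverse \<beta>) ^ j)
    = (\<Sum>i\<le>I. \<Sum>j\<le>J. real_of_int (A i j) * xi y1 z1 (inverse \<beta>) ^ i * xi y2 z2 (inverse \<beta>) ^ j)"
    using gmax \<open>g \<in> R\<close> by (intro sum.mono_neutral_left) (auto simp: R_def)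
  finally show ?thesis by simp
qed

text \<open>Clearing denominators reduces rational polynomials to integer ones, stored as a
  rectangular array padded by zeros.\<close>

lemma alg_independent2I:
  fixes s t :: real
  assumes "\<And>(A :: nat \<Rightarrow> nat \<Rightarrow> int) I J i0 j0. A i0 j0 \<noteq> 0 \<Longrightarrow> i0 \<le> I \<Longrightarrow> j0 \<le> J \<Longrightarrow>
    (\<Sum>i\<le>I. \<Sum>j\<le>J. real_of_int (A i j) * s ^ i * t ^ j) \<noteq> 0"
  shows "alg_independent2 s t"
  unfolding alg_independent2_def
proof (intro allI impI)
  fix P :: "rat poly poly" assume "P \<noteq> 0"
  define J where "J = degree P"
  define I where "I = Max ((\<lambda>j. degree (coeff P j)) ` {..J})"
  define a where "a i j = coeff (coeff P j) i" for i j
  have deg: "degree (coeff P j) \<le> I" if "j \<le> J" for j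
    unfolding I_def using that by (intro Max_ge) auto
  obtain d :: int where d: "d > 0" "\<And>x. x \<in> (\<lambda>(i, j). a i j) ` ({..I} \<times> {..J}) \<Longrightarrow> of_int d * x \<in> \<int>"
    using common_denominator[of "(\<lambda>(i, j). a i j) ` ({..I} \<times> {..J})"] by auto
  \<comment> \<open>The floor is exact for indices in the rectangle, where \<open>d\<close> clears
    the denominators.\<close>
  define A where "A i j = \<lfloor>of_int d * a i j\<rfloor>" for i j
  have A: "real_of_int (A i j) = of_int d * of_rat (a i j)" if "i \<le> I" "j \<le> J" for i j
  proof -
    have "of_int d * a i j \<in> \<int>" using that by (intro d) force
    then have "of_int (A i j) = of_int d * a i j" unfolding A_def by simp
    then have "(of_rat (of_int (A i j)) :: real) = of_rat (of_int d * a i j)" by simp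
    then show ?thesis by (simp add: of_rat_mult)
  qed
  have "a (degree (coeff P J)) J \<noteq> 0" using \<open>P \<noteq> 0\<close> by (simp add: a_def J_def)
  moreover have "real_of_int (A (degree (coeff P J)) J) = of_int d * of_rat (a (degree (coeff P J)) J)"
    using deg[of J] by (intro A) auto
  ultimately have "A (degree (coeff P J)) J \<noteq> 0" using d(1) by auto
  then have "(\<Sum>i\<le>I. \<Sum>j\<le>J. real_of_int (A i j) * s ^ i * t ^ j) \<noteq> 0"
    by (rule assms) (auto intro: deg)
  also have "(\<Sum>i\<le>I. \<Sum>j\<le>J. real_of_int (A i j) * s ^ i * t ^ j)
      = (\<Sum>j\<le>J. \<Sum>i\<le>I. real_of_int (A i j) * s ^ i * t ^ j)"
    by (rule sum.swap)
  also have "\<dots> = (\<Sum>j\<le>J. \<Sum>i\<le>I. of_int d * (of_rat (a i j) * s ^ i * t ^ j))"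
    by (intro sum.cong refl) (simp add: A mult.assoc)
  also have "\<dots> = of_int d * (\<Sum>j\<le>J. \<Sum>i\<le>I. of_rat (a i j) * s ^ i * t ^ j)"
    by (simp add: sum_distrib_left)
  also have "(\<Sum>j\<le>J. \<Sum>i\<le>I. of_rat (a i j) * s ^ i * t ^ j) = eval2 P s t"
    unfolding eval2_altdef J_def [symmetric] a_def
    using deg by (intro sum.cong refl sum.mono_neutral_right) (auto simp: coeff_eq_0)
  finally show "eval2 P s t \<noteq> 0" by simp
qed

theorem theorem3p2:
  fixes y1 z1 y2 z2 \<beta> :: real
  assumes "(y1, z1) \<in> Theta" and "(y2, z2) \<in> Theta"
    and "(y1, z1) \<noteq> (y2, z2)"
    and "pisot \<beta> \<or> salem \<beta>"
  shows "alg_independent2 (xi y1 z1 (inverse \<beta>)) (xi y2 z2 (inverse \<beta>))"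
proof (rule alg_independent2I)
  fix A :: "nat \<Rightarrow> nat \<Rightarrow> int" and I J i0 j0 :: nat
  assume A: "A i0 j0 \<noteq> 0" "i0 \<le> I" "j0 \<le> J"
  consider "y1 < y2 \<or> y1 = y2 \<and> z1 < z2" | "y2 < y1 \<or> y2 = y1 \<and> z2 < z1"
    using assms(3) linorder_less_linear[of y1 y2] linorder_less_linear[of z1 z2] by blast
  then show "(\<Sum>i\<le>I. \<Sum>j\<le>J. real_of_int (A i j) * xi y1 z1 (inverse \<beta>) ^ i * xi y2 z2 (inverse \<beta>) ^ j) \<noteq> 0"
  proof cases
    case 1
    show ?thesis by (rule integer_polynomial_xi_nonzero[OF assms(4,1,2) 1, of A i0 j0]) (rule A)+
  next
    case 2
    \<comment> \<open>The roles of the two series are exchanged by transposing the array.\<close>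
    have "(\<Sum>j\<le>J. \<Sum>i\<le>I. real_of_int (A i j) * xi y2 z2 (inverse \<beta>) ^ j * xi y1 z1 (inverse \<beta>) ^ i) \<noteq> 0"
      by (rule integer_polynomial_xi_nonzero[OF assms(4,2,1) 2, of "\<lambda>j i. A i j" j0 i0]) (rule A)+
    then show ?thesis by (subst sum.swap) (simp add: mult_ac)
  qed
qed

end
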